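(* Let $n\ge1$, let $\mu=(\mu_1,\ldots,\mu_n)\in\mathbb{Z}_{\ge0}^n$ and let $\lambda$ be the weakly decreasing rearrangement of $\mu$. Then $$E_\mu(1,t,t^2,\ldots,t^{n-1};q,t)=t^{n(\lambda)}\prod_{(r,c)\in\mu}\frac{1-q^ct^{v_\mu(r)}}{1-q^{\mu_r-c+1}t^{v_\mu(r)-u_\mu(r,c)}},$$ where $n(\lambda)=\sum_{i=1}^n(i-1)\lambda_i$ and the product is over the boxes $(r,c)$ of $\mu$, i.e. pairs with $r\in\{1,\ldots,n\}$ and $c\in\{1,\ldots,\mu_r\}$.
   Context: Let $q,t^{1/2}$ be independent indeterminates over $\mathbb{C}$, $t=(t^{1/2})^2$, $K=\mathbb{C}(q,t^{1/2})$, $K[X]=K[x_1^{\pm1},\ldots,x_n^{\pm1}]$. $S_n$ acts on $K[X]$ by permuting variables and on $\mathbb{Z}^n$ by $(w\mu)_{w(i)}=\mu_i$; $s_i=(i,i+1)$. Put $\partial_if=\frac{f-s_if}{x_i-x_{i+1}}$. For $\mu\in\mathbb{Z}^n$, $v_\mu\in S_n$ is the minimal length permutation such that $v_\mu\mu$ is weakly increasing; explicitly $v_\mu(r)=1+\#\{r'<r:\mu_{r'}\le\mu_r\}+\#\{r'>r:\mu_{r'}<\mu_r\}$. For a box $(r,c)$ of $\mu\in\mathbb{Z}^n_{\ge0}$, $$u_\mu(r,c)=\#\{r'\in\{1,\ldots,r-1\}:\mu_{r'}\le c-1\}+\#\{r'\in\{r+1,\ldots,n\}:\mu_{r'}<c-1\}.$$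 The electronic (nonsymmetric) Macdonald polynomials $E_\mu=E_\mu(x_1,\ldots,x_n;q,t)\in K[X]$, $\mu\in\mathbb{Z}^n$, are determined by: (E0) $E_{(0,\ldots,0)}=1$; (E1) $E_{(\mu_n+1,\mu_1,\ldots,\mu_{n-1})}=q^{\mu_n}x_1E_\mu(x_2,\ldots,x_n,q^{-1}x_1)$; (E2) if $\mu\in\mathbb{Z}_{\ge0}^n$ and $\mu_i>\mu_{i+1}$ then $E_{s_i\mu}=\partial_i(x_iE_\mu)-tx_i\partial_iE_\mu+\frac{(1-t)a}{1-a}E_\mu$ with $a=q^{\mu_i-\mu_{i+1}}t^{v_\mu(i)-v_\mu(i+1)}$; (E3) $E_{(\mu_1-1,\ldots,\mu_n-1)}=x_1^{-1}\cdots x_n^{-1}E_\mu$. *)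

theory Defs
  imports
    Complex_Main
    "HOL-Library.FuncSet"
    "HOL-Library.Poly_Mapping"
    "HOL-Combinatorics.Permutations"
    "HOL-Computational_Algebra.Polynomial"
    "HOL-Computational_Algebra.Fraction_Field"
begin

text \<open>
  \<open>K\<close> is the field $C(q, t^{1/2})$. The inner polynomial variable is $q$, the outer one is
  $t^{1/2}$.
\<close>

type_synonym K = "complex poly poly fract"

definition q_K :: K where
  "q_K = Fract [:[:0, 1:]:] 1"

definition t_half_K :: K where
  "t_half_K = Fract [:0, 1:] 1"

definition t_K :: K where
  "t_K = t_half_K ^ 2"

text \<open>
  An exponent is a finitely supported map from variable indices to integers, and a Laurent
  polynomial is an element of the group algebra of the group of exponents. Variables are
  numbered from 1; the ring $K[x_1^{\pm 1}, \ldots, x_n^{\pm 1}]$ is the subring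
  \<open>laurent_ring n\<close>.
\<close>

type_synonym laurent = "(nat \<Rightarrow>\<^sub>0 int) \<Rightarrow>\<^sub>0 K"

definition laurent_ring :: "nat \<Rightarrow> laurent set" where
  "laurent_ring n = {f. \<forall>e \<in> Poly_Mapping.keys f. Poly_Mapping.keys e \<subseteq> {1..n}}"

definition const_L :: "K \<Rightarrow> laurent" where
  "const_L c = Poly_Mapping.single 0 c"

definition x_var :: "nat \<Rightarrow> laurent" where
  "x_var i = Poly_Mapping.single (Poly_Mapping.single i 1) 1"

definition x_inv :: "nat \<Rightarrow> laurent" where
  "x_inv i = Poly_Mapping.single (Poly_Mapping.single i (- 1)) 1"

text \<open>The substitution $x_i \mapsto c_i x_{\sigma(i)}$ (for nonzero $c_i$).\<close>

definition laurent_subst :: "(nat \<Rightarrow> K) \<Rightarrow> (nat \<Rightarrow> nat) \<Rightarrow> laurent \<Rightarrow> laurent" where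
  "laurent_subst c \<sigma> f =
     (\<Sum>e \<in> Poly_Mapping.keys f.
        Poly_Mapping.single
          (\<Sum>i \<in> Poly_Mapping.keys e. Poly_Mapping.single (\<sigma> i) (Poly_Mapping.lookup e i))
          (Poly_Mapping.lookup f e *
             (\<Prod>i \<in> Poly_Mapping.keys e. c i powi Poly_Mapping.lookup e i)))"

text \<open>The value at the point $x_i = a_i$ (for nonzero $a_i$).\<close>

definition laurent_eval :: "(nat \<Rightarrow> K) \<Rightarrow> laurent \<Rightarrow> K" where
  "laurent_eval a f =
     (\<Sum>e \<in> Poly_Mapping.keys f.
        Poly_Mapping.lookup f e *
          (\<Prod>i \<in> Poly_Mapping.keys e. a i powi Poly_Mapping.lookup e i))"

text \<open>$w$ sends $x_i$ to $x_{w(i)}$.\<close>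

definition perm_act :: "(nat \<Rightarrow> nat) \<Rightarrow> laurent \<Rightarrow> laurent" where
  "perm_act w = laurent_subst (\<lambda>_. 1) w"

text \<open>
  The divided difference $\partial_i f = (f - s_i f) / (x_i - x_{i+1})$. The quotient exists,
  and it is unique because Laurent polynomials form an integral domain.
\<close>

definition divdiff :: "nat \<Rightarrow> laurent \<Rightarrow> laurent" where
  "divdiff i f =
     (THE g. (x_var i - x_var (Suc i)) * g = f - perm_act (Transposition.transpose i (Suc i)) f)"

text \<open>$Z^n$ is the set of functions on \<open>{1..n}\<close> (extensional, i.e. undefined elsewhere).\<close>

definition int_vecs :: "nat \<Rightarrow> (nat \<Rightarrow> int) set" where
  "int_vecs n = {1..n} \<rightarrow>\<^sub>E UNIV"

definition nonneg_vecs :: "nat \<Rightarrow> (nat \<Rightarrow> int) set" where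
  "nonneg_vecs n = {1..n} \<rightarrow>\<^sub>E {0..}"

text \<open>$(w \mu)_{w(i)} = \mu_i$\<close>

definition vec_act :: "nat \<Rightarrow> (nat \<Rightarrow> nat) \<Rightarrow> (nat \<Rightarrow> int) \<Rightarrow> nat \<Rightarrow> int" where
  "vec_act n w \<mu> = (\<lambda>j\<in>{1..n}. \<mu> (inv w j))"

text \<open>
  The minimal length permutation $v_\mu$ such that $v_\mu \mu$ is weakly increasing, by its
  explicit formula; \<open>v_perm_minimal\<close> below shows that it is this permutation.
\<close>

definition v_perm :: "nat \<Rightarrow> (nat \<Rightarrow> int) \<Rightarrow> nat \<Rightarrow> nat" where
  "v_perm n \<mu> r =
     (if r \<in> {1..n}
      then 1 + card {r' \<in> {1..<r}. \<mu> r' \<le> \<mu> r} + card {r' \<in> {r<..n}. \<mu> r' < \<mu> r}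
      else r)"

definition boxes :: "nat \<Rightarrow> (nat \<Rightarrow> int) \<Rightarrow> (nat \<times> int) set" where
  "boxes n \<mu> = (SIGMA r:{1..n}. {1..\<mu> r})"

definition u_stat :: "nat \<Rightarrow> (nat \<Rightarrow> int) \<Rightarrow> nat \<Rightarrow> int \<Rightarrow> nat" where
  "u_stat n \<mu> r c =
     card {r' \<in> {1..<r}. \<mu> r' \<le> c - 1} + card {r' \<in> {r<..n}. \<mu> r' < c - 1}"

definition decreasing_rearrangement :: "nat \<Rightarrow> (nat \<Rightarrow> int) \<Rightarrow> nat \<Rightarrow> int" where
  "decreasing_rearrangement n \<mu> = (\<lambda>i\<in>{1..n}. rev (sort (map \<mu> [1..<Suc n])) ! (i - 1))"

definition n_stat :: "nat \<Rightarrow> (nat \<Rightarrow> int) \<Rightarrow> int" where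
  "n_stat n \<nu> = (\<Sum>i = 1..n. (int i - 1) * \<nu> i)"

definition inversions :: "nat \<Rightarrow> (nat \<Rightarrow> nat) \<Rightarrow> (nat \<times> nat) set" where
  "inversions n w = {(i, j). i \<in> {1..n} \<and> j \<in> {1..n} \<and> i < j \<and> w j < w i}"

text \<open>The Coxeter length is the number of inversions.\<close>

definition perm_length :: "nat \<Rightarrow> (nat \<Rightarrow> nat) \<Rightarrow> nat" where
  "perm_length n w = card (inversions n w)"

definition sorting_perms :: "nat \<Rightarrow> (nat \<Rightarrow> int) \<Rightarrow> (nat \<Rightarrow> nat) set" where
  "sorting_perms n \<mu> = {w. w permutes {1..n} \<and> mono_on {1..n} (vec_act n w \<mu>)}"

lemma v_perm_less_iff:
  assumes "i \<in> {1..n}" "j \<in> {1..n}"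
  shows "v_perm n \<mu> i < v_perm n \<mu> j \<longleftrightarrow> \<mu> i < \<mu> j \<or> \<mu> i = \<mu> j \<and> i < j"
proof -
  define P where "P a b \<longleftrightarrow> \<mu> a < \<mu> b \<or> \<mu> a = \<mu> b \<and> a < b" for a b :: nat
  have v: "v_perm n \<mu> r = 1 + card {a \<in> {1..n}. P a r}" if "r \<in> {1..n}" for r
  proof -
    have "{a \<in> {1..n}. P a r} = {a \<in> {1..<r}. \<mu> a \<le> \<mu> r} \<union> {a \<in> {r<..n}. \<mu> a < \<mu> r}"
    proof (intro set_eqI)
      fix a
      consider "a < r" | "a = r" | "r < a" by linarith
      then show "a \<in> {a \<in> {1..n}. P a r} \<longleftrightarrow>
          a \<in> {a \<in> {1..<r}. \<mu> a \<le> \<mu> r} \<union> {a \<in> {r<..n}. \<mu> a < \<mu> r}"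
        using that by cases (auto simp: P_def)
    qed
    moreover have "card ({a \<in> {1..<r}. \<mu> a \<le> \<mu> r} \<union> {a \<in> {r<..n}. \<mu> a < \<mu> r}) =
        card {a \<in> {1..<r}. \<mu> a \<le> \<mu> r} + card {a \<in> {r<..n}. \<mu> a < \<mu> r}"
      by (rule card_Un_disjoint) auto
    ultimately show ?thesis using that by (simp add: v_perm_def)
  qed
  have less: "v_perm n \<mu> a < v_perm n \<mu> b" if "a \<in> {1..n}" "b \<in> {1..n}" "P a b" for a b
  proof -
    have "{c \<in> {1..n}. P c a} \<subset> {c \<in> {1..n}. P c b}"
      using that by (auto simp: P_def)
    then have "card {c \<in> {1..n}. P c a} < card {c \<in> {1..n}. P c b}"
      by (intro psubset_card_mono) auto
    then show ?thesis using v that by simp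
  qed
  have "i = j \<or> P i j \<or> P j i" by (auto simp: P_def)
  then show ?thesis
    using less[OF assms] less[OF assms(2,1)] by (auto simp flip: P_def)
qed

lemma v_perm_permutes: "v_perm n \<mu> permutes {1..n}"
proof (rule bij_imp_permutes)
  have inj: "inj_on (v_perm n \<mu>) {1..n}"
  proof (rule inj_onI)
    fix i j assume "i \<in> {1..n}" "j \<in> {1..n}" "v_perm n \<mu> i = v_perm n \<mu> j"
    then show "i = j"
      using v_perm_less_iff[of i n j \<mu>] v_perm_less_iff[of j n i \<mu>] by auto
  qed
  have "v_perm n \<mu> r \<in> {1..n}" if "r \<in> {1..n}" for r
  proof -
    have "card {a \<in> {1..<r}. \<mu> a \<le> \<mu> r} \<le> card {1..<r}"
      "card {a \<in> {r<..n}. \<mu> a < \<mu> r} \<le> card {r<..n}"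
      by (intro card_mono; auto)+
    then show ?thesis using that by (auto simp: v_perm_def)
  qed
  then have "v_perm n \<mu> ` {1..n} \<subseteq> {1..n}" by blast
  then have "v_perm n \<mu> ` {1..n} = {1..n}"
    by (intro endo_inj_surj[OF _ _ inj]) auto
  with inj show "bij_betw (v_perm n \<mu>) {1..n} {1..n}" by (simp add: bij_betw_def)
qed (auto simp: v_perm_def)

lemma inversions_v_perm:
  "inversions n (v_perm n \<mu>) = {(i, j). i \<in> {1..n} \<and> j \<in> {1..n} \<and> i < j \<and> \<mu> j < \<mu> i}"
  unfolding inversions_def using v_perm_less_iff[of _ n _ \<mu>] by auto

lemma sorting_perms_iff:
  assumes "w permutes {1..n}"
  shows "w \<in> sorting_perms n \<mu> \<longleftrightarrow> (\<forall>i\<in>{1..n}. \<forall>j\<in>{1..n}. \<mu> j < \<mu> i \<longrightarrow> w j < w i)"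
proof -
  have [simp]: "inv w (w i) = i" for i
    using permutes_inverses(2)[OF assms] .
  have im: "w i \<in> {1..n} \<longleftrightarrow> i \<in> {1..n}" for i
    using permutes_in_image[OF assms] .
  have ex: "\<exists>i\<in>{1..n}. a = w i" if "a \<in> {1..n}" for a
    using that permutes_image[OF assms] by blast
  have "mono_on {1..n} (vec_act n w \<mu>) \<longleftrightarrow>
      (\<forall>a\<in>{1..n}. \<forall>b\<in>{1..n}. a \<le> b \<longrightarrow> vec_act n w \<mu> a \<le> vec_act n w \<mu> b)"
    by (auto simp: monotone_on_def)
  also have "\<dots> \<longleftrightarrow> (\<forall>i\<in>{1..n}. \<forall>j\<in>{1..n}. w i \<le> w j \<longrightarrow>
      vec_act n w \<mu> (w i) \<le> vec_act n w \<mu> (w j))"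
    using ex im by metis
  also have "\<dots> \<longleftrightarrow> (\<forall>i\<in>{1..n}. \<forall>j\<in>{1..n}. w i \<le> w j \<longrightarrow> \<mu> i \<le> \<mu> j)"
    using im by (simp add: vec_act_def)
  also have "\<dots> \<longleftrightarrow> (\<forall>i\<in>{1..n}. \<forall>j\<in>{1..n}. \<mu> j < \<mu> i \<longrightarrow> w j < w i)"
    by (meson not_le)
  finally show ?thesis
    using assms by (simp add: sorting_perms_def)
qed

theorem v_perm_minimal:
  "v_perm n \<mu> \<in> sorting_perms n \<mu>"
  "w \<in> sorting_perms n \<mu> \<Longrightarrow> w \<noteq> v_perm n \<mu> \<Longrightarrow> perm_length n (v_perm n \<mu>) < perm_length n w"
proof -
  show "v_perm n \<mu> \<in> sorting_perms n \<mu>"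
    using sorting_perms_iff[OF v_perm_permutes] v_perm_less_iff[of _ n _ \<mu>] by auto
next
  let ?v = "v_perm n \<mu>"
  assume w: "w \<in> sorting_perms n \<mu>" and neq: "w \<noteq> ?v"
  have perm: "w permutes {1..n}" using w by (simp add: sorting_perms_def)
  have sorts: "w j < w i" if "i \<in> {1..n}" "j \<in> {1..n}" "\<mu> j < \<mu> i" for i j
    using w that sorting_perms_iff[OF perm] by blast
  have fin: "finite (inversions n w)"
    by (rule finite_subset[of _ "{1..n} \<times> {1..n}"]) (auto simp: inversions_def)
  have sub: "inversions n ?v \<subseteq> inversions n w"
    unfolding inversions_v_perm using sorts by (auto simp: inversions_def)
  moreover have "inversions n ?v \<noteq> inversions n w"
  proof
    assume eq: "inversions n ?v = inversions n w"
    have iff: "w i < w j \<longleftrightarrow> ?v i < ?v j" if ij: "i \<in> {1..n}" "j \<in> {1..n}" for i j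
    proof -
      have *: "w b < w a \<longleftrightarrow> ?v b < ?v a" if "a \<in> {1..n}" "b \<in> {1..n}" "a < b" for a b
      proof -
        have "w b < w a \<longleftrightarrow> (a, b) \<in> inversions n w"
          "?v b < ?v a \<longleftrightarrow> (a, b) \<in> inversions n ?v"
          using that by (auto simp: inversions_def)
        then show ?thesis using eq by simp
      qed
      have "w a \<noteq> w b" "?v a \<noteq> ?v b" if "a \<noteq> b" for a b
        using that permutes_inj[OF perm] permutes_inj[OF v_perm_permutes[of n \<mu>]]
        by (auto dest: injD)
      then show ?thesis
        using *[of i j] *[of j i] ij by (metis linorder_neqE_nat order_less_asym)
    qed
    have rank: "p r = 1 + card {j \<in> {1..n}. p j < p r}"
      if p: "p permutes {1..n}" and r: "r \<in> {1..n}" for p r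
    proof -
      have "p ` {j \<in> {1..n}. p j < p r} = {1..<p r}"
      proof -
        have "p ` {1..n} = {1..n}" by (rule permutes_image[OF p])
        moreover have "p r \<le> n" using permutes_in_image[OF p, of r] r by auto
        ultimately show ?thesis
          by (auto 0 3 simp: set_eq_iff image_iff Bex_def) (metis atLeastAtMost_iff less_imp_le order_trans)+
      qed
      moreover have "inj_on p {j \<in> {1..n}. p j < p r}"
        using permutes_inj[OF p] by (rule inj_on_subset) auto
      ultimately have "card {j \<in> {1..n}. p j < p r} = p r - 1"
        by (metis card_atLeastLessThan card_image)
      moreover have "p r \<ge> 1" using permutes_in_image[OF p, of r] r by auto
      ultimately show ?thesis by simp
    qed
    have "w r = ?v r" for r
    proof (cases "r \<in> {1..n}")
      case True
      then have "{j \<in> {1..n}. w j < w r} = {j \<in> {1..n}. ?v j < ?v r}" using iff by blast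
      then show ?thesis using rank[OF perm True] rank[OF v_perm_permutes True] by simp
    next
      case False
      then show ?thesis
        using permutes_not_in[OF perm] permutes_not_in[OF v_perm_permutes] by metis
    qed
    with neq show False by blast
  qed
  ultimately show "perm_length n ?v < perm_length n w"
    unfolding perm_length_def using fin by (intro psubset_card_mono) auto
qed

text \<open>
  \<open>electronic_macdonald n E\<close> states that \<open>E\<close> is the family $(E_\mu)_{\mu \in Z^n}$ determined
  by its initial value, the cyclic shift relation, the relation for adjacent transpositions, and
  the relation for subtracting $(1, \ldots, 1)$. Values of \<open>E\<close> outside \<open>int_vecs n\<close> are irrelevant.
\<close>

definition electronic_macdonald :: "nat \<Rightarrow> ((nat \<Rightarrow> int) \<Rightarrow> laurent) \<Rightarrow> bool" where
  "electronic_macdonald n E \<longleftrightarrow>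
     (\<forall>\<mu> \<in> int_vecs n. E \<mu> \<in> laurent_ring n) \<and>
     E (\<lambda>i\<in>{1..n}. 0) = 1 \<and>
     (\<forall>\<mu> \<in> int_vecs n.
        E (\<lambda>i\<in>{1..n}. if i = 1 then \<mu> n + 1 else \<mu> (i - 1)) =
          const_L (q_K powi \<mu> n) * x_var 1 *
          laurent_subst (\<lambda>i. if i = n then inverse q_K else 1)
            (\<lambda>i. if i = n then 1 else i + 1) (E \<mu>)) \<and>
     (\<forall>\<mu> \<in> nonneg_vecs n. \<forall>i \<in> {1..<n}. \<mu> i > \<mu> (i + 1) \<longrightarrow>
        (let a = q_K powi (\<mu> i - \<mu> (i + 1)) *
                 t_K powi (int (v_perm n \<mu> i) - int (v_perm n \<mu> (i + 1)))
         in E (vec_act n (Transposition.transpose i (i + 1)) \<mu>) =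
              divdiff i (x_var i * E \<mu>)
              - const_L t_K * x_var i * divdiff i (E \<mu>)
              + const_L ((1 - t_K) * a / (1 - a)) * E \<mu>)) \<and>
     (\<forall>\<mu> \<in> int_vecs n.
        E (\<lambda>i\<in>{1..n}. \<mu> i - 1) = (\<Prod>i = 1..n. x_inv i) * E \<mu>)"

end

theory Submission
  imports Defs
begin

text \<open>
  Write \<open>\<chi>\<close> for evaluation at \<open>(1, t, \<dots>, t\<^sup>n\<^sup>-\<^sup>1)\<close>. Relation (E2) says
  \<open>E_{s_i \<mu>} = (T_i + const) E_\<mu>\<close> for a Demazure-Lusztig operator \<open>T_i\<close>, and \<open>\<chi> \<circ> T_i = \<chi>\<close> because the
  coefficient of \<open>s_i\<close> in \<open>T_i\<close> vanishes at \<open>x_{i+1} = t x_i\<close>; so \<open>\<chi>\<close> of both sides of (E2) are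
  related by an explicit factor. In (E1) the point moves, but every \<open>E_\<mu>\<close> is a joint eigenvector of
  the Cherednik operators, and for the last of them this reads
  \<open>\<pi> E_\<mu> = y S_1 \<cdots> S_{n-1} E_\<mu>\<close> with \<open>\<pi>\<close> the cyclic substitution, \<open>S_i = t T_i\<^sup>-\<^sup>1\<close> and \<open>y\<close> the
  eigenvalue. Since \<open>\<chi> \<circ> S_i = t \<chi>\<close>, again \<open>\<chi>\<close> is only multiplied by an explicit factor. The right-hand
  side of the theorem satisfies the same two recursions, and they reach every composition from 0.

  The operators are not applied to Laurent polynomials but to functions on a set of generic
  points, where division by \<open>x_i - x_{i+1}\<close> is harmless and the relations between them become
  identities of rational functions.
\<close>

section \<open>Generic points and Demazure-Lusztig operators\<close>

lemma q_K_power: "q_K ^ a = Fract [:monom 1 a:] 1"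
proof (induction a)
  case (Suc a)
  then show ?case by (simp add: q_K_def monom_Suc)
qed (simp add: One_fract_def flip: one_pCons)

lemma t_half_K_power: "t_half_K ^ b = Fract (monom 1 b) 1"
proof (induction b)
  case (Suc b)
  then show ?case by (simp add: t_half_K_def monom_Suc)
qed (simp add: One_fract_def)

lemma q_t_power: "q_K ^ a * t_K ^ b = Fract (monom (monom 1 a) (2 * b)) 1"
proof -
  have "t_K ^ b = t_half_K ^ (2 * b)" by (simp add: t_K_def power_mult)
  then show ?thesis by (simp add: q_K_power t_half_K_power smult_monom)
qed

lemma q_t_power_eq_iff: "q_K ^ a * t_K ^ b = q_K ^ c * t_K ^ d \<longleftrightarrow> a = c \<and> b = d"
proof -
  have "monom (monom 1 a) (2 * b) = monom (monom (1::complex) c) (2 * d) \<longleftrightarrow> a = c \<and> b = d"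
    by (auto simp: monom_eq_iff')
  then show ?thesis by (simp add: q_t_power eq_fract)
qed

lemma q_K_nonzero [simp]: "q_K \<noteq> 0"
  by (simp add: q_K_def Zero_fract_def eq_fract)

lemma t_K_nonzero [simp]: "t_K \<noteq> 0"
proof -
  have "t_half_K \<noteq> 0" by (simp add: t_half_K_def Zero_fract_def eq_fract)
  then show ?thesis by (simp add: t_K_def)
qed

text \<open>Moving the negative exponents to the other side leaves an equation between two monomials
  with natural exponents. The genericity of the powers of t and the nonvanishing of the box
  denominators rest on this.\<close>

lemma q_t_powi_eq_1_iff: "q_K powi k * t_K powi j = 1 \<longleftrightarrow> k = 0 \<and> j = 0"
proof -
  have split: "x powi l = x ^ nat l / x ^ nat (- l)" if "x \<noteq> 0" for x :: K and l
    using that by (cases "l \<ge> 0") (auto simp: power_int_def field_simps)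
  have "q_K powi k * t_K powi j = 1 \<longleftrightarrow>
      q_K ^ nat k * t_K ^ nat j = q_K ^ nat (- k) * t_K ^ nat (- j)"
    by (simp add: split divide_eq_eq)
  also have "\<dots> \<longleftrightarrow> k = 0 \<and> j = 0"
    unfolding q_t_power_eq_iff by auto
  finally show ?thesis .
qed

lemma t_powers_generic:
  assumes "i \<noteq> j"
  shows "t_K powi (int i - 1) \<noteq> q_K powi k * t_K powi (int j - 1)"
proof
  assume "t_K powi (int i - 1) = q_K powi k * t_K powi (int j - 1)"
  then have "q_K powi k * t_K powi (int j - int i) = 1"
    by (simp add: power_int_diff field_simps)
  with assms show False by (simp add: q_t_powi_eq_1_iff)
qed

text \<open>
  The denominators \<open>x_i - x_j\<close> stay nonzero on generic points, also after permuting the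
  coordinates and multiplying some of them by powers of \<open>q\<close>.
\<close>

typedef gpoint =
  "{a :: nat \<Rightarrow> K. (\<forall>i. a i \<noteq> 0) \<and> (\<forall>i j k. i \<noteq> j \<longrightarrow> a i \<noteq> q_K powi k * a j)}"
  morphisms coord Abs_gpoint
proof
  show "(\<lambda>i. t_K powi (int i - 1)) \<in> {a :: nat \<Rightarrow> K. (\<forall>i. a i \<noteq> 0) \<and>
      (\<forall>i j k. i \<noteq> j \<longrightarrow> a i \<noteq> q_K powi k * a j)}"
    by (simp add: t_powers_generic)
qed

setup_lifting type_definition_gpoint

lemma coord_nonzero [simp]: "coord p i \<noteq> 0"
  using coord[of p] by simp

lemma coord_eq_iff [simp]: "coord p i = coord p j \<longleftrightarrow> i = j"
proof
  assume "coord p i = coord p j"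
  then have "coord p i = q_K powi 0 * coord p j" by simp
  then show "i = j" using coord[of p] by blast
qed simp

text \<open>
  On indices \<open>i \<ge> 1\<close> this is \<open>t ^ (i - 1)\<close>; the integer exponent keeps index 0 generic as well.
\<close>

lift_definition principal_point :: gpoint is "\<lambda>i. t_K powi (int i - 1)"
  by (simp add: t_powers_generic)

section \<open>Swaps and rotation of generic points\<close>

lift_definition swap_pt :: "nat \<Rightarrow> gpoint \<Rightarrow> gpoint"
  is "\<lambda>i a. a \<circ> Transposition.transpose i (Suc i)"
  by (simp, metis transpose_involutory)

text \<open>Composition with this map is the substitution of (E1), seen on points. Indices outside
  {1..n} stay in place, so that the index map is injective and genericity survives.\<close>

lift_definition rot_pt :: "nat \<Rightarrow> gpoint \<Rightarrow> gpoint"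
  is "\<lambda>n a i. if i = 0 \<or> n < i then a i else if i = n then inverse q_K * a 1 else a (Suc i)"
proof -
  fix n :: nat and a :: "nat \<Rightarrow> K"
  assume a: "(\<forall>i. a i \<noteq> 0) \<and> (\<forall>i j k. i \<noteq> j \<longrightarrow> a i \<noteq> q_K powi k * a j)"
  \<comment> \<open>Each new coordinate is q^(m i) times the old coordinate at w i. As w is
    injective and genericity covers every integer power of q, the extra powers are harmless.\<close>
  define m where "m i = (if i \<noteq> 0 \<and> i = n then - 1 else 0 :: int)" for i
  define w where "w i = (if i = 0 \<or> n < i then i else if i = n then 1 else Suc i)" for i
  define b where
    "b i = (if i = 0 \<or> n < i then a i else if i = n then inverse q_K * a 1 else a (Suc i))" for i
  have b: "b i = q_K powi m i * a (w i)" for i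
    by (simp add: b_def m_def w_def power_int_minus)
  have "b i \<noteq> q_K powi k * b j" if "i \<noteq> j" for i j k
  proof
    assume "b i = q_K powi k * b j"
    then have "a (w i) = q_K powi (k + m j - m i) * a (w j)"
      by (simp add: b power_int_diff power_int_add field_simps)
    moreover have "w i \<noteq> w j"
      using that by (auto simp: w_def split: if_splits)
    ultimately show False using a by blast
  qed
  moreover have "b i \<noteq> 0" for i using a by (simp add: b)
  ultimately show "(\<forall>i. (if i = 0 \<or> n < i then a i else if i = n then inverse q_K * a 1 else a (Suc i)) \<noteq> 0) \<and>
       (\<forall>i j k. i \<noteq> j \<longrightarrow>
         (if i = 0 \<or> n < i then a i else if i = n then inverse q_K * a 1 else a (Suc i)) \<noteq>
         q_K powi k *
         (if j = 0 \<or> n < j then a j else if j = n then inverse q_K * a 1 else a (Suc j)))"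
    unfolding b_def by blast
qed

lemma coord_swap_pt: "coord (swap_pt i p) j = coord p (Transposition.transpose i (Suc i) j)"
  by (simp add: swap_pt.rep_eq)

lemma gpoint_eqI: "(\<And>i. coord p i = coord p' i) \<Longrightarrow> p = p'"
  by (simp add: coord_inject[symmetric] fun_eq_iff)

lemma swap_pt_swap_pt [simp]: "swap_pt i (swap_pt i p) = p"
  by (intro gpoint_eqI) (simp add: coord_swap_pt)

lemma swap_pt_commute:
  assumes "Suc i < j"
  shows "swap_pt i (swap_pt j p) = swap_pt j (swap_pt i p)"
  using assms by (intro gpoint_eqI) (auto simp: coord_swap_pt transpose_def)

lemma swap_pt_braid:
  "swap_pt i (swap_pt (Suc i) (swap_pt i p)) = swap_pt (Suc i) (swap_pt i (swap_pt (Suc i) p))"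
  by (intro gpoint_eqI) (auto simp: coord_swap_pt transpose_def)

lemma rot_pt_swap_pt:
  assumes "1 \<le> i" "Suc i < n"
  shows "swap_pt i (rot_pt n p) = rot_pt n (swap_pt (Suc i) p)"
  using assms by (intro gpoint_eqI) (auto simp: coord_swap_pt rot_pt.rep_eq transpose_def)

text \<open>After two rotations the last two coordinates are q^-1 a_1 and q^-1 a_2, with the same
  power of q. After a single rotation they are a_n and q^-1 a_1.\<close>

lemma rot_pt_rot_pt_swap_pt:
  assumes "n = Suc k" "1 \<le> k"
  shows "swap_pt k (rot_pt n (rot_pt n p)) = rot_pt n (rot_pt n (swap_pt 1 p))"
  using assms by (intro gpoint_eqI) (auto simp: coord_swap_pt rot_pt.rep_eq transpose_def)

text \<open>
  The Demazure-Lusztig operator \<open>f \<mapsto> \<partial>_i (x_i f) - t x_i \<partial>_i f\<close> of (E2) is \<open>hecke_T i\<close>;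
  \<open>hecke i\<close> is \<open>t\<close> times its inverse.
\<close>

definition hecke :: "nat \<Rightarrow> (gpoint \<Rightarrow> K) \<Rightarrow> gpoint \<Rightarrow> K" where
  "hecke i F p =
     ((1 - t_K) * coord p (Suc i) * F p + (t_K * coord p i - coord p (Suc i)) * F (swap_pt i p)) /
     (coord p i - coord p (Suc i))"

definition rot :: "nat \<Rightarrow> (gpoint \<Rightarrow> K) \<Rightarrow> gpoint \<Rightarrow> K" where
  "rot n F p = F (rot_pt n p)"

definition hecke_T :: "nat \<Rightarrow> (gpoint \<Rightarrow> K) \<Rightarrow> gpoint \<Rightarrow> K" where
  "hecke_T i F p = hecke i F p + (1 - t_K) * F p"

definition x_mult :: "nat \<Rightarrow> (gpoint \<Rightarrow> K) \<Rightarrow> gpoint \<Rightarrow> K" where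
  "x_mult j F p = coord p j * F p"

definition scale :: "K \<Rightarrow> (gpoint \<Rightarrow> K) \<Rightarrow> gpoint \<Rightarrow> K" where
  "scale c F p = c * F p"

definition plus_fn :: "(gpoint \<Rightarrow> K) \<Rightarrow> (gpoint \<Rightarrow> K) \<Rightarrow> gpoint \<Rightarrow> K" where
  "plus_fn F G p = F p + G p"

section \<open>Linearity and commutation relations of the operators\<close>

lemma hecke_scale [simp]: "hecke i (scale c F) = scale c (hecke i F)"
  by (simp add: fun_eq_iff hecke_def scale_def divide_inverse algebra_simps)

lemma hecke_plus: "hecke i (plus_fn F G) = plus_fn (hecke i F) (hecke i G)"
  by (simp add: fun_eq_iff hecke_def plus_fn_def divide_inverse algebra_simps)

lemma rot_scale [simp]: "rot n (scale c F) = scale c (rot n F)"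
  by (simp add: fun_eq_iff rot_def scale_def)

lemma rot_plus: "rot n (plus_fn F G) = plus_fn (rot n F) (rot n G)"
  by (simp add: fun_eq_iff rot_def plus_fn_def)

lemma coord_swap_pt_simps [simp]:
  "coord (swap_pt i p) i = coord p (Suc i)"
  "coord (swap_pt i p) (Suc i) = coord p i"
  "j \<noteq> i \<Longrightarrow> j \<noteq> Suc i \<Longrightarrow> coord (swap_pt i p) j = coord p j"
  by (auto simp: coord_swap_pt transpose_def)

text \<open>The Hecke relation (S - t)(S + 1) = 0 on one orbit of a swap: \<open>f\<close> and
  \<open>g\<close> are the values at a point and at its swap, \<open>x\<close> and \<open>y\<close>
  the two coordinates.\<close>

lemma hecke_quadratic_identity:
  fixes x y t f g :: "'a :: field"
  assumes "x \<noteq> y"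
  shows "((1 - t) * y * (((1 - t) * y * f + (t * x - y) * g) / (x - y)) +
      (t * x - y) * (((1 - t) * x * g + (t * y - x) * f) / (y - x))) / (x - y) =
    (t - 1) * (((1 - t) * y * f + (t * x - y) * g) / (x - y)) + t * f"
proof -
  have "y \<noteq> x" using assms by auto
  show ?thesis by (simp add: divide_simps assms \<open>y \<noteq> x\<close>) algebra
qed

lemma hecke_hecke: "hecke i (hecke i F) = plus_fn (scale (t_K - 1) (hecke i F)) (scale t_K F)"
  unfolding fun_eq_iff hecke_def plus_fn_def scale_def
  using hecke_quadratic_identity[of "coord _ i" "coord _ (Suc i)"] by simp

lemma hecke_T_hecke: "hecke_T i (hecke i F) = scale t_K F"
  by (simp add: fun_eq_iff hecke_T_def hecke_hecke plus_fn_def scale_def algebra_simps)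

lemma hecke_commute:
  assumes "Suc i < j"
  shows "hecke i (hecke j F) = hecke j (hecke i F)"
proof
  fix p
  have 1: "coord (swap_pt i p) j = coord p j" "coord (swap_pt i p) (Suc j) = coord p (Suc j)"
     "coord (swap_pt j p) i = coord p i" "coord (swap_pt j p) (Suc i) = coord p (Suc i)"
    using assms by (auto simp: coord_swap_pt transpose_def)
  have 2: "(a * ((b * f + c * g) / d) + e * ((b * h + c * k) / d)) / l =
      (b * ((a * f + e * h) / l) + c * ((a * g + e * k) / l)) / d" for a b c d e f g h k l :: K
    by (simp add: divide_inverse algebra_simps)
  show "hecke i (hecke j F) p = hecke j (hecke i F) p"
    unfolding hecke_def 1 swap_pt_commute[OF assms] by (rule 2)
qed

text \<open>The braid relation on one orbit of the permutations of three coordinates; the six values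
  are those at the six points of the orbit.\<close>

lemma hecke_braid_identity:
  fixes x y z t f0 f1 f2 f12 f21 f121 :: "'a :: field"
  assumes "x \<noteq> y" "y \<noteq> z" "x \<noteq> z"
  defines "S \<equiv> \<lambda>x y f g. ((1 - t) * y * f + (t * x - y) * g) / (x - y)"
  shows "S x y (S y z (S x y f0 f1) (S x z f2 f21)) (S x z (S y x f1 f0) (S y z f12 f121)) =
    S y z (S x y (S y z f0 f2) (S x z f1 f12)) (S x z (S z y f2 f0) (S x y f21 f121))"
proof -
  have "y \<noteq> x" "z \<noteq> y" using assms(1,2) by auto
  show ?thesis unfolding S_def
    by (simp add: divide_simps assms(1-3) \<open>y \<noteq> x\<close> \<open>z \<noteq> y\<close>) algebra
qed

lemma hecke_braid: "hecke i (hecke (Suc i) (hecke i F)) = hecke (Suc i) (hecke i (hecke (Suc i) F))"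
proof
  fix p
  have 1: "coord (swap_pt (Suc i) q) i = coord q i"
    "coord (swap_pt i q) (Suc (Suc i)) = coord q (Suc (Suc i))" for q
    by (auto simp: coord_swap_pt transpose_def)
  show "hecke i (hecke (Suc i) (hecke i F)) p = hecke (Suc i) (hecke i (hecke (Suc i) F)) p"
    unfolding hecke_def coord_swap_pt_simps(1,2) 1 swap_pt_swap_pt swap_pt_braid
    by (rule hecke_braid_identity) auto
qed

lemma rot_hecke:
  assumes "1 \<le> i" "Suc i < n"
  shows "rot n (hecke i F) = hecke (Suc i) (rot n F)"
  using assms by (auto simp: fun_eq_iff rot_def hecke_def rot_pt_swap_pt rot_pt.rep_eq)

text \<open>The two coordinates involved carry the common factor q^-1, which cancels because the
  coefficients of S are homogeneous of degree 0.\<close>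

lemma rot_rot_hecke:
  assumes "n = Suc k" "1 \<le> k"
  shows "rot n (rot n (hecke k F)) = hecke 1 (rot n (rot n F))"
proof
  fix p
  have 1: "coord (rot_pt n (rot_pt n p)) k = inverse q_K * coord p 1"
    "coord (rot_pt n (rot_pt n p)) (Suc k) = inverse q_K * coord p (Suc 1)"
    using assms by (auto simp: rot_pt.rep_eq)
  have 2: "((1 - t) * (u * y) * f + (t * (u * x) - u * y) * g) / (u * x - u * y) =
      ((1 - t) * y * f + (t * x - y) * g) / (x - y)" if "u \<noteq> 0" for t u x y f g :: K
  proof -
    have "((1 - t) * (u * y) * f + (t * (u * x) - u * y) * g) = u * ((1 - t) * y * f + (t * x - y) * g)"
      "u * x - u * y = u * (x - y)"
      by (simp_all add: algebra_simps)
    then show ?thesis using that by simp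
  qed
  show "rot n (rot n (hecke k F)) p = hecke 1 (rot n (rot n F)) p"
    unfolding rot_def hecke_def rot_pt_rot_pt_swap_pt[OF assms] 1 by (rule 2) simp
qed

text \<open>A cross relation of the affine Hecke algebra. Moving the variable out turns S_i into T_i
  = t S_i^-1; when eigenvectors are rotated, these T_i cancel against the S_i of the eigenvalue
  equation.\<close>

lemma hecke_x_mult_self: "hecke i (x_mult i F) = x_mult (Suc i) (hecke_T i F)"
  by (simp add: fun_eq_iff hecke_def x_mult_def hecke_T_def divide_simps) (simp add: algebra_simps)

lemma hecke_x_mult_other:
  assumes "j \<noteq> i" "j \<noteq> Suc i"
  shows "hecke i (x_mult j F) = x_mult j (hecke i F)"
  using assms by (simp add: fun_eq_iff hecke_def x_mult_def divide_inverse algebra_simps)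

section \<open>Joint eigenvectors of the Cherednik operators\<close>

fun descending :: "(nat \<Rightarrow> 'a \<Rightarrow> 'a) \<Rightarrow> nat \<Rightarrow> nat \<Rightarrow> 'a \<Rightarrow> 'a" where
  "descending f i 0 x = x"
| "descending f i (Suc m) x = f (i + m) (descending f i m x)"

text \<open>Both names describe the product as written from left to right: here the highest index
  acts first, whereas in \<open>descending\<close> the index \<open>i\<close> acts first.\<close>

fun ascending :: "(nat \<Rightarrow> 'a \<Rightarrow> 'a) \<Rightarrow> nat \<Rightarrow> nat \<Rightarrow> 'a \<Rightarrow> 'a" where
  "ascending f i 0 x = x"
| "ascending f i (Suc k) x = ascending f i k (f (i + k) x)"

lemma descending_Suc_right: "descending f i (Suc m) x = descending f (Suc i) m (f i x)"
  by (induction m) auto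

lemma ascending_Suc_left: "ascending f i (Suc k) x = f i (ascending f (Suc i) k x)"
  by (induction k arbitrary: x) auto

lemma descending_hecke_scale [simp]: "descending hecke i m (scale c F) = scale c (descending hecke i m F)"
  by (induction m) auto

lemma descending_hecke_plus:
  "descending hecke i m (plus_fn F G) = plus_fn (descending hecke i m F) (descending hecke i m G)"
  by (induction m) (auto simp: hecke_plus)

lemma ascending_hecke_scale [simp]: "ascending hecke i k (scale c F) = scale c (ascending hecke i k F)"
  by (induction k arbitrary: F) auto

lemma ascending_hecke_plus:
  "ascending hecke i k (plus_fn F G) = plus_fn (ascending hecke i k F) (ascending hecke i k G)"
  by (induction k arbitrary: F G) (auto simp: hecke_plus)

lemma descending_hecke_commute:
  assumes "Suc j < i \<or> i + m < j"
  shows "descending hecke i m (hecke j F) = hecke j (descending hecke i m F)"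
  using assms
proof (induction m)
  case (Suc m)
  then have "hecke (i + m) (hecke j (descending hecke i m F)) = hecke j (hecke (i + m) (descending hecke i m F))"
    using hecke_commute[of "i + m" j] hecke_commute[of j "i + m"] by force
  with Suc show ?case by auto
qed simp

lemma ascending_hecke_commute:
  assumes "i + k < j"
  shows "ascending hecke i k (hecke j F) = hecke j (ascending hecke i k F)"
  using assms by (induction k arbitrary: F) (simp_all add: hecke_commute)

text \<open>S_(l+1) moves left past the lower factors up to S_(l+1) S_l. The braid relation rewrites
  S_(l+1) S_l S_(l+1) as S_l S_(l+1) S_l, and the new leftmost S_l passes the higher factors. The
  ascending version is the mirror image.\<close>

lemma descending_hecke_shift:
  assumes "i \<le> l" "Suc l < i + m"
  shows "descending hecke i m (hecke (Suc l) F) = hecke l (descending hecke i m F)"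
  using assms
proof (induction m)
  case (Suc m)
  show ?case
  proof (cases "Suc l < i + m")
    case True
    with Suc show ?thesis by (simp add: hecke_commute[of l "i + m"])
  next
    case False
    with Suc.prems obtain m' where m: "m = Suc m'" "l = i + m'"
      by (metis add_Suc_right le_Suc_ex less_SucE add_left_cancel)
    then show ?thesis by (simp add: descending_hecke_commute hecke_braid)
  qed
qed simp

lemma ascending_hecke_shift:
  assumes "i \<le> l" "Suc l < i + k"
  shows "ascending hecke i k (hecke l F) = hecke (Suc l) (ascending hecke i k F)"
  using assms
proof (induction k arbitrary: F)
  case (Suc k)
  show ?case
  proof (cases "Suc l < i + k")
    case True
    with Suc show ?thesis by (simp flip: hecke_commute[of l "i + k"])
  next
    case False
    with Suc.prems obtain k' where k: "k = Suc k'" "l = i + k'"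
      by (metis add_Suc_right le_Suc_ex less_SucE add_left_cancel)
    then show ?thesis by (simp add: ascending_hecke_commute hecke_braid)
  qed
qed simp

lemma rot_descending_hecke:
  assumes "1 \<le> i" "i + m < n"
  shows "rot n (descending hecke i m F) = descending hecke (Suc i) m (rot n F)"
  using assms by (induction m) (auto simp: rot_hecke)

lemma rot_ascending_hecke:
  assumes "1 \<le> i" "i + k < n"
  shows "rot n (ascending hecke i k F) = ascending hecke (Suc i) k (rot n F)"
  using assms by (induction k arbitrary: F) (auto simp: rot_hecke)

lemma descending_hecke_x_mult_other:
  assumes "j < i"
  shows "descending hecke i m (x_mult j F) = x_mult j (descending hecke i m F)"
  using assms by (induction m) (auto simp: hecke_x_mult_other)

lemma ascending_hecke_x_mult_other:
  assumes "j < i"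
  shows "ascending hecke i k (x_mult j F) = x_mult j (ascending hecke i k F)"
  using assms by (induction k arbitrary: F) (auto simp: hecke_x_mult_other)

lemma descending_hecke_x_mult_first:
  "descending hecke i m (x_mult i F) = x_mult (i + m) (descending hecke_T i m F)"
  by (induction m) (auto simp: hecke_x_mult_self)

lemma hecke_T_scale [simp]: "hecke_T i (scale c F) = scale c (hecke_T i F)"
  by (simp add: fun_eq_iff hecke_T_def) (simp add: scale_def hecke_T_def algebra_simps)

lemma scale_scale [simp]: "scale c (scale d F) = scale (c * d) F"
  by (simp add: fun_eq_iff scale_def)

lemma scale_1 [simp]: "scale 1 F = F"
  by (simp add: fun_eq_iff scale_def)

lemma x_mult_scale [simp]: "x_mult j (scale c F) = scale c (x_mult j F)"
  by (simp add: fun_eq_iff x_mult_def scale_def)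

lemma descending_hecke_T_scale [simp]:
  "descending hecke_T i m (scale c F) = scale c (descending hecke_T i m F)"
  by (induction m) auto

text \<open>The innermost pair T_i S_i gives t, then the next pair does, and the product
  telescopes.\<close>

lemma descending_hecke_T_ascending_hecke:
  "descending hecke_T i m (ascending hecke i m F) = scale (t_K ^ m) F"
  by (induction m arbitrary: F) (auto simp: hecke_T_hecke mult.commute)

lemma rot_x_mult:
  assumes "1 \<le> i" "i < n"
  shows "rot n (x_mult i F) = x_mult (Suc i) (rot n F)"
  using assms by (simp add: fun_eq_iff rot_def x_mult_def rot_pt.rep_eq)

lemma rot_x_mult_last:
  assumes "1 \<le> n"
  shows "rot n (x_mult n F) = scale (inverse q_K) (x_mult 1 (rot n F))"
  using assms by (simp add: fun_eq_iff rot_def x_mult_def scale_def rot_pt.rep_eq)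

text \<open>
  The Cherednik operators are \<open>Y_i = S_{i-1}^{-1} \<cdots> S_1^{-1} \<pi> S_{n-1} \<cdots> S_i\<close>, with
  \<open>S = hecke\<close> and \<open>\<pi> = rot n\<close>; here \<open>Y_i F = y_i F\<close> is stated without inverses.
\<close>

definition joint_eigen :: "nat \<Rightarrow> (nat \<Rightarrow> K) \<Rightarrow> (gpoint \<Rightarrow> K) \<Rightarrow> bool" where
  "joint_eigen n y F \<longleftrightarrow> (\<forall>k m. n = Suc (k + m) \<longrightarrow>
     rot n (descending hecke (Suc k) m F) = scale (y (Suc k)) (ascending hecke 1 k F))"

lemma joint_eigenD:
  "joint_eigen n y F \<Longrightarrow> n = Suc (k + m) \<Longrightarrow>
     rot n (descending hecke (Suc k) m F) = scale (y (Suc k)) (ascending hecke 1 k F)"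
  by (simp add: joint_eigen_def)

text \<open>Since Y_(j+1) = S_j^-1 Y_j S_j^-1, adding a suitable constant to S_j gives an operator
  that exchanges the numbers t^j y_j and t^(j+1) y_(j+1). The equation for \<open>d\<close> makes
  the image proportional to the same combination of S_j F and F.\<close>

lemma joint_eigen_intertwiner:
  assumes F: "joint_eigen n y F" and j: "1 \<le> j" "j < n"
    and d: "(t_K - 1 + d) * y j = d * t_K * y (Suc j)"
  shows "joint_eigen n (y(j := t_K * y (Suc j), Suc j := y j / t_K)) (plus_fn (hecke j F) (scale d F))"
    (is "joint_eigen n ?y ?F")
  unfolding joint_eigen_def
proof (intro allI impI)
  fix k m assume n: "n = Suc (k + m)"
  note eigF = joint_eigenD[OF F]
  consider "j < k" | "j > Suc k" | "j = Suc k" | "j = k" by linarith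
  then show "rot n (descending hecke (Suc k) m ?F) = scale (?y (Suc k)) (ascending hecke 1 k ?F)"
  proof cases
    \<comment> \<open>S_j passes the descending product, becomes S_(j+1) under the rotation, and the
      ascending product turns it back into S_j. In case 2 the descending product lowers the index
      and the rotation raises it again.\<close>
    case 1
    then have "Suc j < n" using n by simp
    with 1 j have "rot n (descending hecke (Suc k) m (hecke j F)) = 
        scale (y (Suc k)) (ascending hecke 1 k (hecke j F))"
      by (simp add: descending_hecke_commute ascending_hecke_shift rot_hecke eigF[OF n])
    with 1 show ?thesis
      by (simp add: descending_hecke_plus ascending_hecke_plus rot_plus eigF[OF n])
        (simp add: fun_eq_iff plus_fn_def scale_def algebra_simps)
  next
    case 2
    then obtain l where l: "j = Suc l" "Suc k \<le> l" by (cases j) auto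
    then have "l < k + m" "Suc l < n" using n j by auto
    with l have "rot n (descending hecke (Suc k) m (hecke j F)) =
        scale (y (Suc k)) (ascending hecke 1 k (hecke j F))"
      by (simp add: descending_hecke_shift ascending_hecke_commute rot_hecke eigF[OF n])
    with 2 show ?thesis
      by (simp add: descending_hecke_plus ascending_hecke_plus rot_plus eigF[OF n])
        (simp add: fun_eq_iff plus_fn_def scale_def algebra_simps)
  next
    \<comment> \<open>Here S_j is the factor of the descending product next to F, so S_j F brings in
      the square of S_j. The quadratic relation reduces it to the eigenvalue equations for j and j +
      1.\<close>
    case 3
    with n j obtain m' where m: "m = Suc m'" by (cases m) auto
    have a: "rot n (descending hecke (Suc (Suc k)) m' (hecke j F)) = scale (y (Suc k)) (ascending hecke 1 k F)"
      using eigF[OF n] unfolding m 3 descending_Suc_right .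
    have b: "rot n (descending hecke (Suc (Suc k)) m' F) = scale (y (Suc (Suc k))) (ascending hecke 1 k (hecke j F))"
      using eigF[of "Suc k" m'] n m 3 by simp
    have "rot n (descending hecke (Suc k) m (hecke j F)) =
        plus_fn (scale ((t_K - 1) * y j) (ascending hecke 1 k F))
          (scale (t_K * y (Suc j)) (ascending hecke 1 k (hecke j F)))"
      unfolding m descending_Suc_right using 3 a b
      by (simp add: hecke_hecke descending_hecke_plus rot_plus)
    then have "rot n (descending hecke (Suc k) m ?F) =
        plus_fn (scale ((t_K - 1 + d) * y j) (ascending hecke 1 k F))
          (scale (t_K * y (Suc j)) (ascending hecke 1 k (hecke j F)))"
      using 3 by (simp add: descending_hecke_plus rot_plus eigF[OF n])
        (simp add: fun_eq_iff plus_fn_def scale_def algebra_simps)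
    with 3 d show ?thesis
      by (simp add: ascending_hecke_plus) (simp add: fun_eq_iff plus_fn_def scale_def algebra_simps)
  next
    \<comment> \<open>Now the square of S_j arises on the right-hand side, where S_j is the factor
      of the ascending product next to F.\<close>
    case 4
    with j obtain k' where k: "k = Suc k'" by (cases k) auto
    have a: "rot n (descending hecke (Suc k) m (hecke j F)) = scale (y j) (ascending hecke 1 k' F)"
      using eigF[of k' "Suc m"] n k 4 by (simp only: descending_Suc_right) simp
    have b: "ascending hecke 1 k F = ascending hecke 1 k' (hecke j F)"
      using k 4 by simp
    have c: "ascending hecke 1 k (hecke j F) = plus_fn (scale (t_K - 1) (ascending hecke 1 k' (hecke j F)))
      (scale t_K (ascending hecke 1 k' F))"
      using k 4 by (simp add: hecke_hecke ascending_hecke_plus)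
    have e: "d * y (Suc k) = (t_K - 1 + d) * y j / t_K" 
      using d 4 by (simp add: field_simps)
    have "rot n (descending hecke (Suc k) m ?F) =
      plus_fn (scale (y j) (ascending hecke 1 k' F)) (scale (d * y (Suc k)) (ascending hecke 1 k' (hecke j F)))"
      unfolding descending_hecke_plus rot_plus descending_hecke_scale rot_scale eigF[OF n] a b scale_scale ..
    also have "\<dots> = scale (y j / t_K) (ascending hecke 1 k ?F)"
      unfolding ascending_hecke_plus c ascending_hecke_scale b e
      by (simp add: fun_eq_iff plus_fn_def scale_def field_simps)
    finally show ?thesis using 4 by simp
  qed
qed

text \<open>As (E1) shifts the entries of \<mu>, its operator shifts the eigenvalues cyclically. The
  factor q^-1 comes from rotating x_n into x_1, the powers of t from cancelling T_i against
  S_i.\<close>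

lemma joint_eigen_rotation:
  assumes F: "joint_eigen n y F" and n: "1 \<le> n"
  shows "joint_eigen n (\<lambda>i. if i = 1 then inverse q_K * t_K ^ (n - 1) * y n else y (i - 1) / t_K)
    (x_mult 1 (rot n F))"
    (is "joint_eigen n ?y ?F")
  unfolding joint_eigen_def
proof (intro allI impI)
  fix k m assume nkm: "n = Suc (k + m)"
  note eigF = joint_eigenD[OF F]
  show "rot n (descending hecke (Suc k) m ?F) = scale (?y (Suc k)) (ascending hecke 1 k ?F)"
  proof (cases k)
    \<comment> \<open>For Y_1, the variable x_1 passes the descending product, comes out as x_n and
      leaves T_(n-1) ... T_1. This cancels the product in rot F = y_n S_1 ... S_(n-1) F up to
      t^(n-1).\<close>
    case 0
    have "rot n F = scale (y n) (ascending hecke 1 m F)"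
      using eigF[of m 0] nkm 0 by simp
    then have "descending hecke_T 1 m (rot n F) = scale (y n * t_K ^ m) F"
      by (simp add: descending_hecke_T_ascending_hecke)
    then have "descending hecke 1 m ?F = scale (y n * t_K ^ m) (x_mult n F)"
      using nkm 0 by (simp add: descending_hecke_x_mult_first)
    then show ?thesis
      using nkm 0 n by (simp add: rot_x_mult_last mult_ac)
  next
    \<comment> \<open>For Y_(k+1), the equation of Y_k is rotated once more. Its outermost factor
      S_(n-1) then comes out as S_1 and is removed by T_1; on the other side T_1 combines with x_2
      into the missing factor S_1 acting on x_1.\<close>
    case (Suc k')
    define D where "D = descending hecke k m F"
    have "rot n (hecke (k + m) D) = scale (y k) (ascending hecke 1 k' F)"
      using eigF[of k' "Suc m"] nkm Suc by (simp add: D_def)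
    then have "rot n (rot n (hecke (k + m) D)) = scale (y k) (ascending hecke 2 k' (rot n F))"
      using nkm Suc by (simp add: rot_ascending_hecke numeral_2_eq_2)
    then have "hecke 1 (rot n (rot n D)) = scale (y k) (ascending hecke 2 k' (rot n F))"
      using nkm Suc by (simp add: rot_rot_hecke)
    then have *: "scale t_K (rot n (rot n D)) = scale (y k) (hecke_T 1 (ascending hecke 2 k' (rot n F)))"
      by (metis hecke_T_hecke hecke_T_scale)
    have "rot n (descending hecke (Suc k) m ?F) = x_mult 2 (rot n (rot n D))"
      using nkm Suc by (simp add: descending_hecke_x_mult_other rot_x_mult D_def rot_descending_hecke numeral_2_eq_2)
    also have "rot n (rot n D) = scale (inverse t_K) (scale t_K (rot n (rot n D)))"
      by (simp add: fun_eq_iff scale_def)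
    also have "x_mult 2 \<dots> = scale (y k / t_K) (x_mult 2 (hecke_T 1 (ascending hecke 2 k' (rot n F))))"
      unfolding * by (simp add: fun_eq_iff scale_def x_mult_def field_simps)
    also have "x_mult 2 (hecke_T 1 (ascending hecke 2 k' (rot n F))) = ascending hecke 1 k ?F"
      unfolding Suc ascending_Suc_left
      by (simp add: ascending_hecke_x_mult_other hecke_x_mult_self numeral_2_eq_2)
    finally show ?thesis using Suc by simp
  qed
qed

section \<open>Constants and the principal point\<close>

lemma hecke_const: "hecke i (\<lambda>_. c) = (\<lambda>_. t_K * c)"
  by (simp add: fun_eq_iff hecke_def divide_simps) (simp add: algebra_simps)

lemma descending_hecke_const: "descending hecke i m (\<lambda>_. c) = (\<lambda>_. t_K ^ m * c)"
  by (induction m) (auto simp: hecke_const)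

lemma ascending_hecke_const: "ascending hecke i k (\<lambda>_. c) = (\<lambda>_. t_K ^ k * c)"
  by (induction k arbitrary: c) (auto simp: hecke_const)

text \<open>S_i multiplies constants by t, so the eigenvalue of Y_(k+1) is t^(m-k), and m - k = n +
  1 - 2(k+1).\<close>

lemma joint_eigen_const:
  "joint_eigen n (\<lambda>i. t_K powi (int n + 1 - 2 * int i)) (\<lambda>_. c)"
  unfolding joint_eigen_def
proof (intro allI impI)
  fix k m assume n: "n = Suc (k + m)"
  have "t_K powi (int n + 1 - 2 * int (Suc k)) * t_K ^ k = t_K powi (int n + 1 - 2 * int (Suc k) + int k)"
    by (subst power_int_add) auto
  also have "int n + 1 - 2 * int (Suc k) + int k = int m" using n by simp
  finally have "t_K ^ m = t_K powi (int n + 1 - 2 * int (Suc k)) * t_K ^ k"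
    by (simp only: power_int_of_nat)
  then show "rot n (descending hecke (Suc k) m (\<lambda>_. c)) =
      scale (t_K powi (int n + 1 - 2 * int (Suc k))) (ascending hecke 1 k (\<lambda>_. c))"
    unfolding descending_hecke_const ascending_hecke_const
    by (simp add: fun_eq_iff rot_def scale_def)
qed

text \<open>Where x_(i+1) = t x_i, the coefficient of the swapped value vanishes and the other one
  is (1 - t) t x_i / (x_i - t x_i) = t.\<close>

lemma hecke_principal_point: 
  assumes "1 \<le> i"
  shows "hecke i F principal_point = t_K * F principal_point"
proof -
  let ?x = "coord principal_point"
  have y: "?x (Suc i) = t_K * ?x i"
    using power_int_add_1'[of t_K "int i - 1"] by (simp add: principal_point.rep_eq mult_ac)
  have "?x i - ?x (Suc i) \<noteq> 0" by simp
  then have "1 - t_K \<noteq> 0" "?x i - t_K * ?x i = (1 - t_K) * ?x i" using y by (auto simp: algebra_simps)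
  then show ?thesis
    unfolding hecke_def y by simp
qed

text \<open>In the equation of Y_n the descending product is empty. It therefore expresses the value
  at the rotated point through S_1 ... S_(n-1) F, and each S_i contributes t at the principal
  point.\<close>

lemma joint_eigen_principal_point:
  assumes "joint_eigen n y F" "1 \<le> n"
  shows "F (rot_pt n principal_point) = y n * t_K ^ (n - 1) * F principal_point"
proof -
  have *: "ascending hecke 1 k G principal_point = t_K ^ k * G principal_point" for k G
    by (induction k arbitrary: G) (auto simp: hecke_principal_point)
  have "rot n F = scale (y n) (ascending hecke 1 (n - 1) F)"
    using joint_eigenD[OF assms(1), of "n - 1" 0] assms(2) by simp
  then have "rot n F principal_point = scale (y n) (ascending hecke 1 (n - 1) F) principal_point"
    by simp
  then show ?thesis unfolding rot_def scale_def * by (simp only: mult.assoc)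
qed

section \<open>Laurent polynomials as functions\<close>

definition monom_eval :: "(nat \<Rightarrow> K) \<Rightarrow> (nat \<Rightarrow>\<^sub>0 int) \<Rightarrow> K" where
  "monom_eval a e = (\<Prod>i \<in> Poly_Mapping.keys e. a i powi Poly_Mapping.lookup e i)"

lemma monom_eval_superset:
  assumes "finite A" "Poly_Mapping.keys e \<subseteq> A"
  shows "monom_eval a e = (\<Prod>i \<in> A. a i powi Poly_Mapping.lookup e i)"
  unfolding monom_eval_def using assms
  by (intro prod.mono_neutral_left) (auto simp: in_keys_iff)

lemma monom_eval_0 [simp]: "monom_eval a 0 = 1"
  by (simp add: monom_eval_def)

lemma monom_eval_single [simp]: "monom_eval a (Poly_Mapping.single i k) = a i powi k"
  by (simp add: monom_eval_def)

lemma monom_eval_add: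
  assumes "\<And>i. a i \<noteq> 0"
  shows "monom_eval a (e + e') = monom_eval a e * monom_eval a e'"
proof -
  let ?A = "Poly_Mapping.keys e \<union> Poly_Mapping.keys e'"
  have "Poly_Mapping.keys (e + e') \<subseteq> ?A" by (rule keys_add)
  then have "monom_eval a (e + e') = (\<Prod>i \<in> ?A. a i powi Poly_Mapping.lookup (e + e') i)"
    by (intro monom_eval_superset) auto
  also have "\<dots> = (\<Prod>i \<in> ?A. a i powi Poly_Mapping.lookup e i) *
      (\<Prod>i \<in> ?A. a i powi Poly_Mapping.lookup e' i)"
    using assms by (simp add: lookup_add power_int_add prod.distrib)
  finally show ?thesis by (simp add: monom_eval_superset[of ?A])
qed

lemma monom_eval_sum:
  assumes "\<And>i. a i \<noteq> 0"
  shows "monom_eval a (\<Sum>i \<in> A. f i) = (\<Prod>i \<in> A. monom_eval a (f i))"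
  by (induction A rule: infinite_finite_induct) (auto simp: monom_eval_add assms)

lemma laurent_eval_superset:
  assumes "finite A" "Poly_Mapping.keys f \<subseteq> A"
  shows "laurent_eval a f = (\<Sum>e \<in> A. Poly_Mapping.lookup f e * monom_eval a e)"
  unfolding laurent_eval_def monom_eval_def using assms
  by (intro sum.mono_neutral_left) (auto simp: in_keys_iff)

lemma laurent_eval_0 [simp]: "laurent_eval a 0 = 0"
  by (simp add: laurent_eval_def)

lemma laurent_eval_single [simp]: "laurent_eval a (Poly_Mapping.single e c) = c * monom_eval a e"
  by (subst laurent_eval_superset[of "{e}"]) auto

lemma laurent_eval_1 [simp]: "laurent_eval a 1 = 1"
  unfolding single_one[symmetric] laurent_eval_single by simp

lemma laurent_eval_add [simp]: "laurent_eval a (f + g) = laurent_eval a f + laurent_eval a g"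
proof -
  let ?A = "Poly_Mapping.keys f \<union> Poly_Mapping.keys g"
  have "Poly_Mapping.keys (f + g) \<subseteq> ?A" by (rule keys_add)
  then have "laurent_eval a (f + g) = (\<Sum>e \<in> ?A. Poly_Mapping.lookup (f + g) e * monom_eval a e)"
    by (intro laurent_eval_superset) auto
  also have "\<dots> = (\<Sum>e \<in> ?A. Poly_Mapping.lookup f e * monom_eval a e) +
      (\<Sum>e \<in> ?A. Poly_Mapping.lookup g e * monom_eval a e)"
    by (simp add: lookup_add algebra_simps sum.distrib)
  finally show ?thesis by (simp add: laurent_eval_superset[of ?A])
qed

lemma laurent_eval_diff [simp]: "laurent_eval a (f - g) = laurent_eval a f - laurent_eval a g"
  using laurent_eval_add[of a "f - g" g] by simp

lemma laurent_eval_sum: "laurent_eval a (\<Sum>i \<in> A. f i) = (\<Sum>i \<in> A. laurent_eval a (f i))"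
  by (induction A rule: infinite_finite_induct) auto

lemma laurent_induct [case_names single add]:
  fixes f :: laurent
  assumes "\<And>e c. P (Poly_Mapping.single e c)" "\<And>f g. P f \<Longrightarrow> P g \<Longrightarrow> P (f + g)"
  shows "P f"
proof (induction f rule: update_induct)
  case const
  show ?case using assms(1)[of 0 0] by simp
next
  case (update f e c)
  \<comment> \<open>The exponent \<open>e\<close> is not yet a key of \<open>f\<close>, so updating
    amounts to adding a monomial.\<close>
  have "Poly_Mapping.update e c f = f + Poly_Mapping.single e c"
    using update.hyps
    by (intro poly_mapping_eqI) (auto simp: lookup_update lookup_add lookup_single when_def in_keys_iff)
  with update assms show ?case by simp
qed

lemma laurent_eval_mult [simp]:
  assumes "\<And>i. a i \<noteq> 0"
  shows "laurent_eval a (f * g) = laurent_eval a f * laurent_eval a g"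
proof (induction f rule: laurent_induct)
  case (single e c)
  show ?case
  proof (induction g rule: laurent_induct)
    case (single e' c')
    show ?case by (simp add: mult_single monom_eval_add assms)
  qed (simp add: algebra_simps)
qed (simp add: algebra_simps)

lemma laurent_eval_x_var [simp]: "laurent_eval a (x_var i) = a i"
  by (simp add: x_var_def)

lemma laurent_eval_const_L [simp]: "laurent_eval a (const_L c) = c"
  by (simp add: const_L_def)

lemma laurent_eval_subst:
  assumes "\<And>i. a i \<noteq> 0" "\<And>i. c i \<noteq> 0"
  shows "laurent_eval a (laurent_subst c \<sigma> f) = laurent_eval (\<lambda>i. c i * a (\<sigma> i)) f"
  unfolding laurent_subst_def laurent_eval_sum laurent_eval_single monom_eval_sum[OF assms(1)]
    laurent_eval_def[of "\<lambda>i. c i * a (\<sigma> i)"]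
  by (simp add: power_int_mult_distrib prod.distrib mult.assoc)

text \<open>Outside {1..n} the points \<open>rot_pt\<close> and \<open>principal_point\<close> need
  not agree with the substitution of (E1) and with the powers t^(i-1); this lemma makes the
  difference harmless.\<close>

lemma laurent_eval_cong:
  assumes "f \<in> laurent_ring n" "\<And>i. i \<in> {1..n} \<Longrightarrow> a i = b i"
  shows "laurent_eval a f = laurent_eval b f"
  unfolding laurent_eval_def
proof (intro sum.cong refl arg_cong2[where f = times] prod.cong)
  fix e i assume "e \<in> Poly_Mapping.keys f" "i \<in> Poly_Mapping.keys e"
  with assms show "a i powi Poly_Mapping.lookup e i = b i powi Poly_Mapping.lookup e i"
    unfolding laurent_ring_def by (metis (mono_tags, lifting) mem_Collect_eq subsetD)
qed

lemma laurent_eval_perm_act: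
  assumes "\<And>i. a i \<noteq> 0"
  shows "laurent_eval a (perm_act w f) = laurent_eval (a \<circ> w) f"
  unfolding perm_act_def using assms by (simp add: laurent_eval_subst comp_def)

section \<open>Divided differences of Laurent polynomials\<close>

lemma laurent_subst_superset:
  assumes "finite A" "Poly_Mapping.keys f \<subseteq> A"
  shows "laurent_subst c \<sigma> f = (\<Sum>e \<in> A.
        Poly_Mapping.single
          (\<Sum>i \<in> Poly_Mapping.keys e. Poly_Mapping.single (\<sigma> i) (Poly_Mapping.lookup e i))
          (Poly_Mapping.lookup f e *
             (\<Prod>i \<in> Poly_Mapping.keys e. c i powi Poly_Mapping.lookup e i)))"
  unfolding laurent_subst_def using assms
  by (intro sum.mono_neutral_left) (auto simp: in_keys_iff)

lemma laurent_subst_add: "laurent_subst c \<sigma> (f + g) = laurent_subst c \<sigma> f + laurent_subst c \<sigma> g"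
proof -
  let ?A = "Poly_Mapping.keys f \<union> Poly_Mapping.keys g"
  show ?thesis
    using keys_add[of f g]
    by (simp add: laurent_subst_superset[of ?A] lookup_add algebra_simps single_add sum.distrib)
qed

lemma perm_act_add: "perm_act w (f + g) = perm_act w f + perm_act w g"
  by (simp add: perm_act_def laurent_subst_add)

lemma perm_act_single:
  "perm_act w (Poly_Mapping.single e c) =
    Poly_Mapping.single (\<Sum>i \<in> Poly_Mapping.keys e. Poly_Mapping.single (w i) (Poly_Mapping.lookup e i)) c"
  unfolding perm_act_def by (subst laurent_subst_superset[of "{e}"]) auto

text \<open>Exchanging two entries moves their difference \<open>d\<close> from place i to place j,
  so the swapped monomial is x^e (x_j / x_i)^d. This form prepares the divisibility by x_i -
  x_j.\<close>

lemma swap_exponent: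
  fixes e :: "nat \<Rightarrow>\<^sub>0 int"
  assumes "i \<noteq> j"
  defines "d \<equiv> Poly_Mapping.lookup e i - Poly_Mapping.lookup e j"
  shows "(\<Sum>k \<in> Poly_Mapping.keys e.
      Poly_Mapping.single (Transposition.transpose i j k) (Poly_Mapping.lookup e k)) =
    e - Poly_Mapping.single i d + Poly_Mapping.single j d"
proof (intro poly_mapping_eqI)
  fix l
  have "Transposition.transpose i j k = l \<longleftrightarrow> k = Transposition.transpose i j l" for k
    by (auto simp: transpose_eq_iff)
  then show "Poly_Mapping.lookup (\<Sum>k \<in> Poly_Mapping.keys e.
      Poly_Mapping.single (Transposition.transpose i j k) (Poly_Mapping.lookup e k)) l =
    Poly_Mapping.lookup (e - Poly_Mapping.single i d + Poly_Mapping.single j d) l"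
    using assms
    by (auto simp: lookup_sum lookup_single when_def in_keys_iff lookup_add lookup_minus transpose_def)
qed

lemma x_var_power: "x_var i ^ k = Poly_Mapping.single (Poly_Mapping.single i (int k)) 1"
  by (induction k) (auto simp: x_var_def mult_single simp flip: single_add)

text \<open>For d >= 0 the difference is a monomial times x_i^d - x_j^d. For d = -k it is a
  monomial, now lowered at j instead of i, times -(x_i^k - x_j^k).\<close>

lemma x_var_dvd_single_diff:
  assumes "i \<noteq> j"
  shows "x_var i - x_var j dvd
    Poly_Mapping.single e c - perm_act (Transposition.transpose i j) (Poly_Mapping.single e c)"
proof -
  define d where "d = Poly_Mapping.lookup e i - Poly_Mapping.lookup e j"
  have p: "perm_act (Transposition.transpose i j) (Poly_Mapping.single e c) =
      Poly_Mapping.single (e - Poly_Mapping.single i d + Poly_Mapping.single j d) c"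
    unfolding perm_act_single swap_exponent[OF assms] d_def ..
  have dvd: "x_var i - x_var j dvd x_var i ^ k - x_var j ^ k" for k
    by (simp add: dvdI power_diff_sumr2)
  show ?thesis
  proof (cases "d \<ge> 0")
    case True
    then obtain k where k: "d = int k" by (metis nonneg_int_cases)
    have "Poly_Mapping.single e c - Poly_Mapping.single (e - Poly_Mapping.single i d + Poly_Mapping.single j d) c =
        Poly_Mapping.single (e - Poly_Mapping.single i d) c * (x_var i ^ k - x_var j ^ k)"
      by (simp add: x_var_power k algebra_simps mult_single)
    then show ?thesis unfolding p using dvd by (metis dvd_mult)
  next
    case False
    then obtain k where k: "d = - int k" by (metis nle_le nonpos_int_cases)
    have "Poly_Mapping.single e c - Poly_Mapping.single (e - Poly_Mapping.single i d + Poly_Mapping.single j d) c =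
        Poly_Mapping.single (e + Poly_Mapping.single j d) (- c) * (x_var i ^ k - x_var j ^ k)"
      by (simp add: x_var_power k algebra_simps mult_single single_uminus)
    then show ?thesis unfolding p using dvd by (metis dvd_mult)
  qed
qed

lemma x_var_dvd_diff:
  assumes "i \<noteq> j"
  shows "x_var i - x_var j dvd f - perm_act (Transposition.transpose i j) f"
proof (induction f rule: laurent_induct)
  case (single e c)
  show ?case by (rule x_var_dvd_single_diff[OF assms])
next
  case (add f g)
  then show ?case using dvd_add[OF add] by (simp add: perm_act_add algebra_simps)
qed

text \<open>Divisibility gives the quotient and cancellation its uniqueness, so the definite
  description satisfies its equation.\<close>

lemma divdiff_eq:
  "(x_var i - x_var (Suc i)) * divdiff i f = f - perm_act (Transposition.transpose i (Suc i)) f"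
  unfolding divdiff_def
proof (rule theI')
  have "x_var i - x_var (Suc i) \<noteq> 0"
  proof
    assume "x_var i - x_var (Suc i) = 0"
    then have "Poly_Mapping.single i (1::int) = Poly_Mapping.single (Suc i) 1"
      by (metis x_var_def inj_single keys_single eq_iff_diff_eq_0 one_neq_zero singleton_inject)
    then show False by (metis keys_single singleton_inject n_not_Suc_n one_neq_zero)
  qed
  then show "\<exists>!g. (x_var i - x_var (Suc i)) * g = f - perm_act (Transposition.transpose i (Suc i)) f"
    using x_var_dvd_diff[of i "Suc i" f] by (metis dvd_def mult_left_cancel n_not_Suc_n)
qed

section \<open>The operators of (E1) and (E2) on generic points\<close>

definition laurent_fun :: "laurent \<Rightarrow> gpoint \<Rightarrow> K" where
  "laurent_fun f p = laurent_eval (coord p) f"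

lemma laurent_fun_divdiff:
  "laurent_fun (divdiff i f) p = (laurent_fun f p - laurent_fun f (swap_pt i p)) / (coord p i - coord p (Suc i))"
proof -
  have "laurent_eval (coord p) ((x_var i - x_var (Suc i)) * divdiff i f) = laurent_fun f p - laurent_fun f (swap_pt i p)"
    unfolding divdiff_eq by (simp add: laurent_fun_def laurent_eval_perm_act swap_pt.rep_eq)
  then show ?thesis by (simp add: laurent_fun_def field_simps)
qed

text \<open>The first two terms form T_i = S_i + 1 - t. Written through S_i, the operator has the
  shape S_i + d treated by \<open>joint_eigen_intertwiner\<close>, and 1 - t joins the
  constant.\<close>

lemma laurent_fun_demazure_lusztig:
  "laurent_fun (divdiff i (x_var i * f) - const_L t_K * x_var i * divdiff i f + const_L c * f) =
    plus_fn (hecke i (laurent_fun f)) (scale (1 - t_K + c) (laurent_fun f))"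
proof
  fix p
  have "laurent_fun (divdiff i (x_var i * f) - const_L t_K * x_var i * divdiff i f + const_L c * f) p =
    (coord p i * laurent_fun f p - coord p (Suc i) * laurent_fun f (swap_pt i p)) / (coord p i - coord p (Suc i)) -
    t_K * coord p i * ((laurent_fun f p - laurent_fun f (swap_pt i p)) / (coord p i - coord p (Suc i))) + c * laurent_fun f p"
    unfolding laurent_fun_divdiff[symmetric] using laurent_fun_divdiff[of i "x_var i * f" p]
    by (simp add: laurent_fun_def)
  also have "\<dots> = plus_fn (hecke i (laurent_fun f)) (scale (1 - t_K + c) (laurent_fun f)) p"
    by (simp add: plus_fn_def scale_def hecke_def divide_simps) (simp add: algebra_simps)
  finally show "laurent_fun (divdiff i (x_var i * f) - const_L t_K * x_var i * divdiff i f + const_L c * f) p =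
    plus_fn (hecke i (laurent_fun f)) (scale (1 - t_K + c) (laurent_fun f)) p" .
qed

lemma laurent_fun_rotation:
  assumes "f \<in> laurent_ring n" "1 \<le> n"
  shows "laurent_fun (const_L c * x_var 1 * laurent_subst (\<lambda>i. if i = n then inverse q_K else 1)
            (\<lambda>i. if i = n then 1 else i + 1) f) = scale c (x_mult 1 (rot n (laurent_fun f)))"
proof
  fix p
  have "laurent_eval (\<lambda>i. (if i = n then inverse q_K else 1) * coord p (if i = n then 1 else i + 1)) f =
      laurent_fun f (rot_pt n p)"
    unfolding laurent_fun_def using assms(1) by (rule laurent_eval_cong) (auto simp: rot_pt.rep_eq)
  then show "laurent_fun (const_L c * x_var 1 * laurent_subst (\<lambda>i. if i = n then inverse q_K else 1)
            (\<lambda>i. if i = n then 1 else i + 1) f) p = scale c (x_mult 1 (rot n (laurent_fun f))) p"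
    by (simp add: laurent_fun_def laurent_eval_subst scale_def x_mult_def rot_def)
qed

lemma laurent_fun_principal_point:
  assumes "f \<in> laurent_ring n"
  shows "laurent_fun f principal_point = laurent_eval (\<lambda>i. t_K ^ (i - 1)) f"
  unfolding laurent_fun_def using assms
proof (rule laurent_eval_cong)
  fix i assume "i \<in> {1..n}"
  then have "int i - 1 = int (i - 1)" by simp
  then show "coord principal_point i = t_K ^ (i - 1)"
    unfolding principal_point.rep_eq by (simp only: power_int_of_nat)
qed

section \<open>Compositions and the box product\<close>

definition rotate_vec :: "nat \<Rightarrow> (nat \<Rightarrow> int) \<Rightarrow> nat \<Rightarrow> int" where
  "rotate_vec n \<mu> = (\<lambda>i\<in>{1..n}. if i = 1 then \<mu> n + 1 else \<mu> (i - 1))"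

definition swap_vec :: "nat \<Rightarrow> nat \<Rightarrow> (nat \<Rightarrow> int) \<Rightarrow> nat \<Rightarrow> int" where
  "swap_vec n j \<mu> = vec_act n (Transposition.transpose j (j + 1)) \<mu>"

lemma swap_vec_apply:
  "i \<in> {1..n} \<Longrightarrow> swap_vec n j \<mu> i = \<mu> (Transposition.transpose j (Suc j) i)"
  by (simp add: swap_vec_def vec_act_def)

lemma transpose_Suc_in:
  "j \<in> {1..<n} \<Longrightarrow> i \<in> {1..n} \<Longrightarrow> Transposition.transpose j (Suc j) i \<in> {1..n}"
  by (auto simp: transpose_def)

lemma bij_betw_transpose_Suc:
  assumes "j \<in> {1..<n}"
  shows "bij_betw (Transposition.transpose j (Suc j)) {1..n} {1..n}"
  using assms transpose_Suc_in[OF assms] by (intro bij_betwI[where g = "Transposition.transpose j (Suc j)"]) auto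

lemma swap_vec_transpose:
  assumes "j \<in> {1..<n}" "i \<in> {1..n}"
  shows "swap_vec n j \<mu> (Transposition.transpose j (Suc j) i) = \<mu> i"
  using transpose_Suc_in[OF assms] by (simp add: swap_vec_apply)

lemma swap_vec_nonneg:
  assumes "\<mu> \<in> nonneg_vecs n" "j \<in> {1..<n}"
  shows "swap_vec n j \<mu> \<in> nonneg_vecs n"
proof -
  have "0 \<le> swap_vec n j \<mu> i" if "i \<in> {1..n}" for i
    using assms(1) transpose_Suc_in[OF assms(2) that] that
    by (auto simp: swap_vec_apply nonneg_vecs_def Pi_iff PiE_def)
  then show ?thesis by (auto simp: nonneg_vecs_def swap_vec_def vec_act_def)
qed

lemma swap_vec_swap_vec:
  assumes "\<mu> \<in> nonneg_vecs n" "j \<in> {1..<n}"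
  shows "swap_vec n j (swap_vec n j \<mu>) = \<mu>"
proof
  fix i
  show "swap_vec n j (swap_vec n j \<mu>) i = \<mu> i"
  proof (cases "i \<in> {1..n}")
    case True
    then show ?thesis
      using transpose_Suc_in[OF assms(2) True] by (simp add: swap_vec_apply)
  next
    case False
    then have "\<mu> i = undefined" using assms(1) unfolding nonneg_vecs_def by (rule PiE_arb[rotated])
    with False show ?thesis unfolding swap_vec_def vec_act_def by (simp only: restrict_apply if_False)
  qed
qed

text \<open>The swap rule is read backwards: moving the first positive entry one place to the left
  creates a descent there, and the rule leads from that vector to the given one. Repetition brings
  the entry to place 1 without changing the sum.\<close>

lemma nonneg_vecs_zero_prefix_induct:
  assumes n: "n \<ge> 1" and \<mu>: "\<mu> \<in> nonneg_vecs n"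
    and swap: "\<And>\<mu> j. \<mu> \<in> nonneg_vecs n \<Longrightarrow> j \<in> {1..<n} \<Longrightarrow> \<mu> j > \<mu> (j + 1) \<Longrightarrow> P \<mu> \<Longrightarrow> P (swap_vec n j \<mu>)"
    and first: "\<And>\<mu>. \<mu> \<in> nonneg_vecs n \<Longrightarrow> sum \<mu> {1..n} = N \<Longrightarrow> \<mu> 1 > 0 \<Longrightarrow> P \<mu>"
    and N: "sum \<mu> {1..n} = N" and k: "k \<in> {1..n}" "\<mu> k > 0" "\<And>i. i \<in> {1..<k} \<Longrightarrow> \<mu> i = 0"
  shows "P \<mu>"
  using \<mu> N k
proof (induction k arbitrary: \<mu>)
  case (Suc k)
  show ?case
  proof (cases "k = 0")
    case True
    with Suc.prems first show ?thesis by simp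
  next
    case False
    define \<nu> where "\<nu> = swap_vec n k \<mu>"
    have k: "k \<in> {1..<n}" using False Suc.prems by auto
    have \<nu>: "\<nu> \<in> nonneg_vecs n" unfolding \<nu>_def by (rule swap_vec_nonneg[OF Suc.prems(1) k])
    have \<nu>_k: "\<nu> k = \<mu> (Suc k)" "\<nu> (Suc k) = 0" "\<And>i. i \<in> {1..<k} \<Longrightarrow> \<nu> i = 0"
      using Suc.prems k by (auto simp: \<nu>_def swap_vec_apply)
    have "sum \<nu> {1..n} = sum \<mu> {1..n}"
      unfolding \<nu>_def sum.reindex_bij_betw[OF bij_betw_transpose_Suc[OF k], of "swap_vec n k \<mu>", symmetric]
      by (intro sum.cong swap_vec_transpose[OF k] refl)
    then have "P \<nu>"
      using k Suc.prems(2,4) \<nu>_k by (intro Suc.IH \<nu>) simp_all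
    moreover have "\<nu> k > \<nu> (k + 1)" using \<nu>_k Suc.prems(4) by simp
    ultimately have "P (swap_vec n k \<nu>)" by (intro swap \<nu> k)
    then show ?thesis unfolding \<nu>_def swap_vec_swap_vec[OF Suc.prems(1) k] .
  qed
qed simp

text \<open>Induction on the sum of the entries. A nonzero vector is reduced to vectors with
  positive first entry, and such a vector is the rotation of one whose sum is smaller by 1.\<close>

lemma nonneg_vecs_induct [consumes 2, case_names zero rotate swap]:
  assumes n: "n \<ge> 1" and \<mu>: "\<mu> \<in> nonneg_vecs n"
    and zero: "P (\<lambda>i\<in>{1..n}. 0)"
    and rot: "\<And>\<mu>. \<mu> \<in> nonneg_vecs n \<Longrightarrow> P \<mu> \<Longrightarrow> P (rotate_vec n \<mu>)"
    and swap: "\<And>\<mu> j. \<mu> \<in> nonneg_vecs n \<Longrightarrow> j \<in> {1..<n} \<Longrightarrow> \<mu> j > \<mu> (j + 1) \<Longrightarrow> P \<mu> \<Longrightarrow> P (swap_vec n j \<mu>)"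
  shows "P \<mu>"
  using \<mu>
proof (induction "nat (sum \<mu> {1..n})" arbitrary: \<mu> rule: less_induct)
  case less
  have pos: "0 \<le> \<mu> i" if "i \<in> {1..n}" for i using less.prems that by (auto simp: nonneg_vecs_def)
  have first: "P \<mu>'" if \<mu>': "\<mu>' \<in> nonneg_vecs n" "sum \<mu>' {1..n} = sum \<mu> {1..n}" "\<mu>' 1 > 0" for \<mu>'
  proof -
    define \<nu> where "\<nu> = (\<lambda>i\<in>{1..n}. if i = n then \<mu>' 1 - 1 else \<mu>' (Suc i))"
    have \<nu>: "\<nu> \<in> nonneg_vecs n"
    proof -
      have "0 \<le> \<mu>' i" if "i \<in> {1..n}" for i using \<mu>'(1) that by (auto simp: nonneg_vecs_def)
      then have "0 \<le> (if i = n then \<mu>' 1 - 1 else \<mu>' (Suc i))" if "i \<in> {1..n}" for i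
        using \<mu>'(3) that by simp
      then show ?thesis unfolding nonneg_vecs_def \<nu>_def by (intro restrict_PiE_iff[THEN iffD2]) simp
    qed
    have rot': "rotate_vec n \<nu> = \<mu>'"
    proof
      fix i show "rotate_vec n \<nu> i = \<mu>' i"
      proof (cases "i \<in> {1..n}")
        case True
        then show ?thesis using n by (auto simp: rotate_vec_def \<nu>_def)
      next
        case False
        then have "\<mu>' i = undefined" using \<mu>'(1) unfolding nonneg_vecs_def by (rule PiE_arb[rotated])
        with False show ?thesis unfolding rotate_vec_def by (simp only: restrict_apply if_False)
      qed
    qed
    obtain n' where n': "n = Suc n'" using n by (cases n) auto
    have "sum \<nu> {1..n} = sum \<nu> {1..n'} + \<nu> n" unfolding n' by (rule sum.cl_ivl_Suc[THEN trans]) simp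
    also have "sum \<nu> {1..n'} = (\<Sum>i = 1..n'. \<mu>' (Suc i))"
      by (intro sum.cong) (simp_all add: \<nu>_def n')
    also have "\<dots> = sum \<mu>' {Suc 1..n}" unfolding n' by (rule sum.shift_bounds_cl_Suc_ivl[symmetric])
    also have "\<nu> n = \<mu>' 1 - 1" using n by (simp add: \<nu>_def)
    also have "sum \<mu>' {Suc 1..n} + (\<mu>' 1 - 1) = sum \<mu>' {1..n} - 1"
      unfolding sum.atLeast_Suc_atMost[OF n, of \<mu>'] by simp
    finally have s: "sum \<nu> {1..n} = sum \<mu> {1..n} - 1" using \<mu>'(2) by simp
    have "0 \<le> sum \<nu> {1..n}" using \<nu> by (intro sum_nonneg) (auto simp: nonneg_vecs_def)
    then have "nat (sum \<nu> {1..n}) < nat (sum \<mu> {1..n})" using s by linarith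
    then have "P \<nu>" by (rule less.hyps[OF _ \<nu>])
    then show ?thesis using rot[OF \<nu>] rot' by simp
  qed
  show ?case
  proof (cases "\<exists>k\<in>{1..n}. \<mu> k > 0")
    case True
    define k where "k = (LEAST k. k \<in> {1..n} \<and> \<mu> k > 0)"
    have k: "k \<in> {1..n} \<and> \<mu> k > 0" unfolding k_def by (rule LeastI_ex) (use True in blast)
    have least: "\<mu> i = 0" if "i \<in> {1..<k}" for i
    proof -
      have "\<not> (i \<in> {1..n} \<and> \<mu> i > 0)" using not_less_Least[of i "\<lambda>k. k \<in> {1..n} \<and> \<mu> k > 0"] that unfolding k_def by simp
      moreover have "i \<in> {1..n}" using that k by simp
      ultimately show ?thesis using pos[of i] by simp
    qed
    show ?thesis
      by (rule nonneg_vecs_zero_prefix_induct[of n \<mu> P,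
          OF n less.prems swap first refl conjunct1[OF k] conjunct2[OF k] least])
  next
    case False
    have "\<mu> i = (\<lambda>i\<in>{1..n}. 0) i" for i
    proof (cases "i \<in> {1..n}")
      case True
      then have "\<mu> i = 0" using pos[OF True] False by force
      with True show ?thesis by (simp only: restrict_apply if_True)
    next
      case False
      then have "\<mu> i = undefined" using less.prems unfolding nonneg_vecs_def by (rule PiE_arb[rotated])
      with False show ?thesis by (simp only: restrict_apply if_False)
    qed
    then have "\<mu> = (\<lambda>i\<in>{1..n}. 0)" ..
    then show ?thesis using zero by simp
  qed
qed

section \<open>Transport of the statistics v and u along rotations and swaps\<close>

lemma v_perm_eq_card:
  assumes "r \<in> {1..n}"
  shows "v_perm n \<mu> r = Suc (card {a \<in> {1..n}. \<mu> a < \<mu> r \<or> \<mu> a = \<mu> r \<and> a < r})"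
proof -
  have "{a \<in> {1..n}. \<mu> a < \<mu> r \<or> \<mu> a = \<mu> r \<and> a < r} =
      {a \<in> {1..<r}. \<mu> a \<le> \<mu> r} \<union> {a \<in> {r<..n}. \<mu> a < \<mu> r}"
    using assms by (auto, (metis linorder_neqE_nat order_less_irrefl)+)
  moreover have "card \<dots> = card {a \<in> {1..<r}. \<mu> a \<le> \<mu> r} + card {a \<in> {r<..n}. \<mu> a < \<mu> r}"
    by (rule card_Un_disjoint) auto
  ultimately show ?thesis using assms by (simp add: v_perm_def)
qed

text \<open>As for v, two counts merge into one: the rows other than r are compared with the pair (c
  - 1, r) in the lexicographic order of value and place. A single count over all places can be
  carried along a bijection.\<close>

lemma u_stat_eq_card:
  assumes "r \<in> {1..n}"
  shows "u_stat n \<mu> r c = card {a \<in> {1..n}. a \<noteq> r \<and> (\<mu> a < c - 1 \<or> \<mu> a = c - 1 \<and> a < r)}"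
proof -
  have "{a \<in> {1..n}. a \<noteq> r \<and> (\<mu> a < c - 1 \<or> \<mu> a = c - 1 \<and> a < r)} =
      {a \<in> {1..<r}. \<mu> a \<le> c - 1} \<union> {a \<in> {r<..n}. \<mu> a < c - 1}"
    using assms by auto
  moreover have "card \<dots> = card {a \<in> {1..<r}. \<mu> a \<le> c - 1} + card {a \<in> {r<..n}. \<mu> a < c - 1}"
    by (rule card_Un_disjoint) auto
  ultimately show ?thesis by (simp add: u_stat_def)
qed

lemma card_bij_betw_Collect:
  assumes g: "bij_betw g A A" and Q: "\<And>a. a \<in> A \<Longrightarrow> Q (g a) \<longleftrightarrow> R a"
  shows "card {a \<in> A. Q a} = card {a \<in> A. R a}"
proof -
  have "bij_betw g {a \<in> A. R a} {a \<in> A. Q a}"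
    using g Q unfolding bij_betw_def inj_on_def by (auto 0 4)
  then show ?thesis by (metis bij_betw_same_card)
qed

lemma v_perm_transport:
  assumes g: "bij_betw g {1..n} {1..n}" and r: "r \<in> {1..n}"
    and iff: "\<And>a. a \<in> {1..n} \<Longrightarrow>
      (\<nu> (g a) < \<nu> (g r) \<or> \<nu> (g a) = \<nu> (g r) \<and> g a < g r) \<longleftrightarrow> (\<mu> a < \<mu> r \<or> \<mu> a = \<mu> r \<and> a < r)"
  shows "v_perm n \<nu> (g r) = v_perm n \<mu> r"
proof -
  have "g r \<in> {1..n}" using g r by (metis bij_betwE)
  then show ?thesis
    unfolding v_perm_eq_card[OF r] v_perm_eq_card[OF \<open>g r \<in> {1..n}\<close>]
    using card_bij_betw_Collect[OF g, of "\<lambda>a. \<nu> a < \<nu> (g r) \<or> \<nu> a = \<nu> (g r) \<and> a < g r"] iff by auto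
qed

lemma u_stat_transport:
  assumes g: "bij_betw g {1..n} {1..n}" and r: "r \<in> {1..n}"
    and iff: "\<And>a. a \<in> {1..n} \<Longrightarrow> a \<noteq> r \<Longrightarrow>
      (\<nu> (g a) < c' - 1 \<or> \<nu> (g a) = c' - 1 \<and> g a < g r) \<longleftrightarrow> (\<mu> a < c - 1 \<or> \<mu> a = c - 1 \<and> a < r)"
  shows "u_stat n \<nu> (g r) c' = u_stat n \<mu> r c"
proof -
  have "g r \<in> {1..n}" using g r by (metis bij_betwE)
  moreover have "g a = g r \<longleftrightarrow> a = r" if "a \<in> {1..n}" for a
    using inj_on_eq_iff[OF bij_betw_imp_inj_on[OF g] that r] .
  ultimately show ?thesis
    unfolding u_stat_eq_card[OF r] u_stat_eq_card[OF \<open>g r \<in> {1..n}\<close>]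
    using iff by (intro card_bij_betw_Collect[OF g]) auto
qed

definition rotate_index :: "nat \<Rightarrow> nat \<Rightarrow> nat" where
  "rotate_index n a = (if a = n then 1 else Suc a)"

lemma bij_betw_rotate_index:
  assumes "1 \<le> n"
  shows "bij_betw (rotate_index n) {1..n} {1..n}"
  using assms by (intro bij_betwI[where g = "\<lambda>a. if a = 1 then n else a - 1"]) (auto simp: rotate_index_def)

lemma rotate_vec_rotate_index:
  "a \<in> {1..n} \<Longrightarrow> rotate_vec n \<mu> (rotate_index n a) = (if a = n then \<mu> n + 1 else \<mu> a)"
  by (auto simp: rotate_vec_def rotate_index_def)

lemma rotate_vec_first: "1 \<le> n \<Longrightarrow> rotate_vec n \<mu> (Suc 0) = \<mu> n + 1"
  and rotate_vec_Suc: "1 \<le> a \<Longrightarrow> a < n \<Longrightarrow> rotate_vec n \<mu> (Suc a) = \<mu> a"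
  by (simp_all add: rotate_vec_def)

text \<open>Raising the last entry by 1 while moving it to the front preserves the lexicographic
  order of value and place: \<mu>_a <= \<mu>_n before means \<mu>_a < \<mu>_n + 1 after.\<close>

lemma v_perm_rotate_vec:
  assumes "r \<in> {1..n}"
  shows "v_perm n (rotate_vec n \<mu>) (rotate_index n r) = v_perm n \<mu> r"
proof (rule v_perm_transport[where g = "rotate_index n"])
  show "bij_betw (rotate_index n) {1..n} {1..n}" using assms by (intro bij_betw_rotate_index) auto
qed (use assms in \<open>auto simp: rotate_vec_first rotate_vec_Suc rotate_index_def\<close>)

lemma u_stat_rotate_vec:
  assumes "r \<in> {1..n}" "r \<noteq> n"
  shows "u_stat n (rotate_vec n \<mu>) (rotate_index n r) c = u_stat n \<mu> r c"
proof (rule u_stat_transport[where g = "rotate_index n"])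
  show "bij_betw (rotate_index n) {1..n} {1..n}" using assms by (intro bij_betw_rotate_index) auto
qed (use assms in \<open>auto simp: rotate_vec_first rotate_vec_Suc rotate_index_def\<close>)

text \<open>Seen from the last place, ties with c - 1 are counted; seen from the first place, ties
  are not. Raising the threshold to c compensates for this.\<close>

lemma u_stat_rotate_vec_last:
  assumes "1 \<le> n"
  shows "u_stat n (rotate_vec n \<mu>) (rotate_index n n) (c + 1) = u_stat n \<mu> n c"
proof (rule u_stat_transport[where g = "rotate_index n"])
  show "bij_betw (rotate_index n) {1..n} {1..n}" using assms by (intro bij_betw_rotate_index) auto
qed (use assms in \<open>auto simp: rotate_vec_first rotate_vec_Suc rotate_index_def\<close>)

lemma transpose_Suc_less_iff:
  "Transposition.transpose j (Suc j) a < Transposition.transpose j (Suc j) b \<longleftrightarrow>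
    (if a = j \<and> b = Suc j then False else if a = Suc j \<and> b = j then True else a < b)"
  by (auto simp: transpose_def)

lemma v_perm_swap_vec:
  assumes "j \<in> {1..<n}" "\<mu> j > \<mu> (j + 1)" "r \<in> {1..n}"
  shows "v_perm n (swap_vec n j \<mu>) (Transposition.transpose j (Suc j) r) = v_perm n \<mu> r"
  using assms
  by (intro v_perm_transport[where g = "Transposition.transpose j (Suc j)"] bij_betw_transpose_Suc)
    (auto simp: swap_vec_transpose transpose_Suc_less_iff simp del: transpose_apply_first transpose_apply_second)

text \<open>The rows at j and j + 1 change their relative order, which matters only for a tie with c
  - 1. Among boxes the only such tie is the excluded column in row j.\<close>

lemma u_stat_swap_vec:
  assumes "j \<in> {1..<n}" "\<mu> j > \<mu> (j + 1)" "r \<in> {1..n}"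
    and "r = j \<Longrightarrow> c \<noteq> \<mu> (j + 1) + 1" "r = Suc j \<Longrightarrow> c \<le> \<mu> (j + 1)"
  shows "u_stat n (swap_vec n j \<mu>) (Transposition.transpose j (Suc j) r) c = u_stat n \<mu> r c"
  using assms
  by (intro u_stat_transport[where g = "Transposition.transpose j (Suc j)"] bij_betw_transpose_Suc)
    (auto simp: swap_vec_transpose transpose_Suc_less_iff simp del: transpose_apply_first transpose_apply_second)

text \<open>At the exceptional box the threshold is the entry \<mu>_(j+1) itself. Before the swap
  this entry lies behind row j and is not counted; after the swap it lies in front and is.\<close>

lemma u_stat_swap_box:
  assumes "j \<in> {1..<n}" "\<mu> j > \<mu> (j + 1)"
  shows "Suc (u_stat n \<mu> j (\<mu> (j + 1) + 1)) = v_perm n \<mu> (j + 1)"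
    and "u_stat n (swap_vec n j \<mu>) (j + 1) (\<mu> (j + 1) + 1) = v_perm n \<mu> (j + 1)"
proof -
  let ?\<nu> = "swap_vec n j \<mu>"
  have j: "j \<in> {1..n}" "j + 1 \<in> {1..n}" using assms(1) by auto
  have "{a \<in> {1..n}. a \<noteq> j \<and> (\<mu> a < \<mu> (j + 1) \<or> \<mu> a = \<mu> (j + 1) \<and> a < j)} =
      {a \<in> {1..n}. \<mu> a < \<mu> (j + 1) \<or> \<mu> a = \<mu> (j + 1) \<and> a < j + 1}"
    using assms by (auto simp: less_Suc_eq)
  then show "Suc (u_stat n \<mu> j (\<mu> (j + 1) + 1)) = v_perm n \<mu> (j + 1)"
    unfolding u_stat_eq_card[OF j(1)] v_perm_eq_card[OF j(2)] by simp
  have "v_perm n \<mu> (j + 1) = v_perm n ?\<nu> j"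
    using v_perm_swap_vec[OF assms j(2)] by simp
  have \<nu>: "?\<nu> j = \<mu> (j + 1)" "?\<nu> (j + 1) = \<mu> j" using j by (simp_all add: swap_vec_apply)
  have "{a \<in> {1..n}. a \<noteq> j + 1 \<and> (?\<nu> a < ?\<nu> j \<or> ?\<nu> a = ?\<nu> j \<and> a < j + 1)} =
      insert j {a \<in> {1..n}. ?\<nu> a < ?\<nu> j \<or> ?\<nu> a = ?\<nu> j \<and> a < j}"
    using j \<nu> assms(2) by (auto simp: less_Suc_eq)
  moreover have "card \<dots> = v_perm n ?\<nu> j"
    unfolding v_perm_eq_card[OF j(1)] by (subst card_insert_disjoint) auto
  ultimately show "u_stat n ?\<nu> (j + 1) (\<mu> (j + 1) + 1) = v_perm n \<mu> (j + 1)"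
    unfolding u_stat_eq_card[OF j(2)] \<open>v_perm n \<mu> (j + 1) = v_perm n ?\<nu> j\<close> using \<nu> by simp
qed

text \<open>The entry at i has place v(i) in the increasing rearrangement, hence place n + 1 - v(i)
  in the decreasing one, which gives it the weight n - v(i).\<close>

lemma n_stat_decreasing_rearrangement:
  "n_stat n (decreasing_rearrangement n \<mu>) = (\<Sum>i = 1..n. (int n - int (v_perm n \<mu> i)) * \<mu> i)"
proof -
  let ?v = "v_perm n \<mu>"
  let ?\<nu> = "\<lambda>i. \<mu> (inv ?v i)"
  note perm = v_perm_permutes[of n \<mu>]
  have bij: "bij_betw (inv ?v) {1..n} {1..n}"
    by (rule permutes_imp_bij[OF permutes_inv[OF perm]])
  have "sort (map \<mu> [1..<Suc n]) = map ?\<nu> [1..<Suc n]"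
  proof (rule properties_for_sort)
    have "image_mset \<mu> (mset_set {1..n}) = image_mset \<mu> (image_mset (inv ?v) (mset_set {1..n}))"
      using bij by (simp add: image_mset_mset_set bij_betw_def)
    then show "mset (map ?\<nu> [1..<Suc n]) = mset (map \<mu> [1..<Suc n])"
      by (simp add: atLeastLessThanSuc_atLeastAtMost image_mset.compositionality comp_def del: upt_Suc)
    have "mono_on {1..n} (vec_act n ?v \<mu>)"
      using v_perm_minimal(1)[of n \<mu>] by (simp add: sorting_perms_def)
    then show "sorted (map ?\<nu> [1..<Suc n])"
      by (auto simp: sorted_iff_nth_mono vec_act_def monotone_on_def simp del: upt_Suc)
  qed
  then have dec: "decreasing_rearrangement n \<mu> i = ?\<nu> (Suc n - i)" if "i \<in> {1..n}" for i
    using that by (auto simp: decreasing_rearrangement_def rev_nth Suc_diff_le simp del: upt_Suc)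
  have "n_stat n (decreasing_rearrangement n \<mu>) = (\<Sum>i = 1..n. (int i - 1) * ?\<nu> (Suc n - i))"
    unfolding n_stat_def by (intro sum.cong) (auto simp: dec)
  also have "\<dots> = (\<Sum>i = 1..n. (int n - int i) * ?\<nu> i)"
    by (rule sum.reindex_bij_witness[of _ "\<lambda>i. Suc n - i" "\<lambda>i. Suc n - i"]) (auto simp: of_nat_diff)
  also have "\<dots> = (\<Sum>i = 1..n. (int n - int (?v i)) * \<mu> i)"
    using permutes_inverses[OF perm] permutes_in_image[OF perm] permutes_in_image[OF permutes_inv[OF perm]]
    by (intro sum.reindex_bij_witness[of _ ?v "inv ?v"]) auto
  finally show ?thesis .
qed

lemma n_stat_rotate_vec:
  assumes "1 \<le> n"
  shows "n_stat n (decreasing_rearrangement n (rotate_vec n \<mu>)) =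
    n_stat n (decreasing_rearrangement n \<mu>) + int n - int (v_perm n \<mu> n)"
proof -
  have "n_stat n (decreasing_rearrangement n (rotate_vec n \<mu>)) =
    (\<Sum>i = 1..n. (int n - int (v_perm n (rotate_vec n \<mu>) (rotate_index n i))) * rotate_vec n \<mu> (rotate_index n i))"
    unfolding n_stat_decreasing_rearrangement
    by (rule sum.reindex_bij_betw[OF bij_betw_rotate_index[OF assms], symmetric])
  also have "\<dots> = (\<Sum>i = 1..n. (int n - int (v_perm n \<mu> i)) * \<mu> i +
      (if i = n then int n - int (v_perm n \<mu> n) else 0))"
    by (intro sum.cong) (auto simp: v_perm_rotate_vec rotate_vec_rotate_index algebra_simps)
  also have "\<dots> = n_stat n (decreasing_rearrangement n \<mu>) + (int n - int (v_perm n \<mu> n))"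
    using assms by (simp add: sum.distrib n_stat_decreasing_rearrangement)
  finally show ?thesis by simp
qed

lemma n_stat_swap_vec:
  assumes "j \<in> {1..<n}" "\<mu> j > \<mu> (j + 1)"
  shows "n_stat n (decreasing_rearrangement n (swap_vec n j \<mu>)) = n_stat n (decreasing_rearrangement n \<mu>)"
proof -
  let ?s = "Transposition.transpose j (Suc j)"
  have "n_stat n (decreasing_rearrangement n (swap_vec n j \<mu>)) =
      (\<Sum>i = 1..n. (int n - int (v_perm n (swap_vec n j \<mu>) (?s i))) * swap_vec n j \<mu> (?s i))"
    unfolding n_stat_decreasing_rearrangement
    by (rule sum.reindex_bij_betw[OF bij_betw_transpose_Suc[OF assms(1)], symmetric])
  also have "\<dots> = (\<Sum>i = 1..n. (int n - int (v_perm n \<mu> i)) * \<mu> i)"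
    by (rule sum.cong) (simp_all only: v_perm_swap_vec[OF assms] swap_vec_transpose[OF assms(1)])
  finally show ?thesis unfolding n_stat_decreasing_rearrangement .
qed

section \<open>The box product, row by row\<close>

definition numer :: "nat \<Rightarrow> (nat \<Rightarrow> int) \<Rightarrow> nat \<Rightarrow> int \<Rightarrow> K" where
  "numer n \<mu> r c = 1 - q_K powi c * t_K ^ v_perm n \<mu> r"

definition denom :: "nat \<Rightarrow> (nat \<Rightarrow> int) \<Rightarrow> nat \<Rightarrow> int \<Rightarrow> K" where
  "denom n \<mu> r c =
     1 - q_K powi (\<mu> r - c + 1) * t_K powi (int (v_perm n \<mu> r) - int (u_stat n \<mu> r c))"

definition row_factor :: "nat \<Rightarrow> (nat \<Rightarrow> int) \<Rightarrow> nat \<Rightarrow> K" where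
  "row_factor n \<mu> r = (\<Prod>c \<in> {1..\<mu> r}. numer n \<mu> r c / denom n \<mu> r c)"

definition box_product :: "nat \<Rightarrow> (nat \<Rightarrow> int) \<Rightarrow> K" where
  "box_product n \<mu> = (\<Prod>(r, c) \<in> boxes n \<mu>. numer n \<mu> r c / denom n \<mu> r c)"

lemma box_product_rows: "box_product n \<mu> = (\<Prod>r = 1..n. row_factor n \<mu> r)"
  unfolding box_product_def boxes_def row_factor_def by (rule prod.Sigma[symmetric]) auto

lemma one_minus_q_t_nonzero: "k \<noteq> 0 \<Longrightarrow> 1 - q_K powi k * t_K powi j \<noteq> 0"
  using q_t_powi_eq_1_iff[of k j] by auto

lemma denom_nonzero: "c \<le> \<mu> r \<Longrightarrow> denom n \<mu> r c \<noteq> 0"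
  unfolding denom_def by (rule one_minus_q_t_nonzero) simp

lemma numer_nonzero: "1 \<le> c \<Longrightarrow> numer n \<mu> r c \<noteq> 0"
  unfolding numer_def using one_minus_q_t_nonzero[of c "int (v_perm n \<mu> r)"] by simp

text \<open>Only row n gains a box. Its numerators gain the factor of column m + 1, its denominators
  shift by one column, and the new first box has u = 0, so that its denominator cancels the new
  numerator.\<close>

lemma row_factor_rotate_vec:
  assumes \<mu>: "\<mu> \<in> nonneg_vecs n" and r: "r \<in> {1..n}"
  shows "row_factor n (rotate_vec n \<mu>) (rotate_index n r) = row_factor n \<mu> r"
proof (cases "r = n")
  case False
  then show ?thesis using r
    unfolding row_factor_def numer_def denom_def
    by (simp add: rotate_vec_rotate_index v_perm_rotate_vec u_stat_rotate_vec)
next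
  case True
  let ?\<nu> = "rotate_vec n \<mu>" and ?i = "rotate_index n n"
  define m where "m = \<mu> n"
  have n: "1 \<le> n" "n \<in> {1..n}" using r by auto
  have nonneg: "0 \<le> \<mu> i" if "i \<in> {1..n}" for i using \<mu> that by (auto simp: nonneg_vecs_def)
  have m: "0 \<le> m" using nonneg n by (simp add: m_def)
  have \<nu>: "?\<nu> ?i = m + 1" using n by (simp add: rotate_vec_rotate_index m_def)
  have v: "v_perm n ?\<nu> ?i = v_perm n \<mu> n" using n by (simp add: v_perm_rotate_vec)
  \<comment> \<open>Column 0 is no box of the old row, but the shift by one column sends it to the
    new first box. No entry is as small as -1, so the count is zero.\<close>
  have "u_stat n \<mu> n 0 = 0"
    unfolding u_stat_eq_card[OF n(2)] using nonneg by (force simp: card_eq_0_iff)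
  then have u1: "u_stat n ?\<nu> ?i 1 = 0"
    using u_stat_rotate_vec_last[OF n(1), of \<mu> 0] by simp
  have num: "(\<Prod>c \<in> {1..m + 1}. numer n ?\<nu> ?i c) = numer n \<mu> n (m + 1) * (\<Prod>c \<in> {1..m}. numer n \<mu> n c)"
  proof -
    have "{1..m + 1} = insert (m + 1) {1..m}" using m by auto
    then show ?thesis by (simp add: numer_def v)
  qed
  have den: "(\<Prod>c \<in> {1..m + 1}. denom n ?\<nu> ?i c) = numer n \<mu> n (m + 1) * (\<Prod>c \<in> {1..m}. denom n \<mu> n c)"
  proof -
    have "(\<lambda>c. c + 1) ` {1..m} = {2..m + 1}" by simp
    moreover have "{1..m + 1} = insert 1 {2..m + 1}" using m by auto
    ultimately have "(\<Prod>c \<in> {1..m + 1}. denom n ?\<nu> ?i c) =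
        denom n ?\<nu> ?i 1 * (\<Prod>c \<in> (\<lambda>c. c + 1) ` {1..m}. denom n ?\<nu> ?i c)"
      by simp
    also have "(\<Prod>c \<in> (\<lambda>c. c + 1) ` {1..m}. denom n ?\<nu> ?i c) = (\<Prod>c \<in> {1..m}. denom n ?\<nu> ?i (c + 1))"
      by (subst prod.reindex) (auto simp: inj_on_def)
    also have "\<dots> = (\<Prod>c \<in> {1..m}. denom n \<mu> n c)"
      by (intro prod.cong) (simp_all add: denom_def \<nu> v u_stat_rotate_vec_last[OF n(1)] m_def)
    also have "denom n ?\<nu> ?i 1 = numer n \<mu> n (m + 1)"
      by (simp add: denom_def numer_def \<nu> v u1)
    finally show ?thesis .
  qed
  have "numer n \<mu> n (m + 1) \<noteq> 0" using m by (intro numer_nonzero) simp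
  then show ?thesis
    unfolding True row_factor_def \<nu> prod_dividef num den by (simp add: m_def)
qed

lemma box_product_rotate_vec:
  assumes "\<mu> \<in> nonneg_vecs n" "1 \<le> n"
  shows "box_product n (rotate_vec n \<mu>) = box_product n \<mu>"
proof -
  have "box_product n (rotate_vec n \<mu>) = (\<Prod>r = 1..n. row_factor n (rotate_vec n \<mu>) (rotate_index n r))"
    unfolding box_product_rows
    by (rule prod.reindex_bij_betw[OF bij_betw_rotate_index[OF assms(2)], symmetric])
  also have "\<dots> = box_product n \<mu>"
    unfolding box_product_rows by (rule prod.cong) (simp_all only: row_factor_rotate_vec[OF assms(1)])
  finally show ?thesis .
qed

lemma row_factor_swap_vec:
  assumes "j \<in> {1..<n}" "\<mu> j > \<mu> (j + 1)" "r \<in> {1..n}" "r \<noteq> j"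
  shows "row_factor n (swap_vec n j \<mu>) (Transposition.transpose j (Suc j) r) = row_factor n \<mu> r"
  unfolding row_factor_def
proof (rule prod.cong)
  show "{1..swap_vec n j \<mu> (Transposition.transpose j (Suc j) r)} = {1..\<mu> r}"
    using assms by (simp add: swap_vec_transpose)
  fix c assume "c \<in> {1..\<mu> r}"
  then have "u_stat n (swap_vec n j \<mu>) (Transposition.transpose j (Suc j) r) c = u_stat n \<mu> r c"
    using assms by (intro u_stat_swap_vec) auto
  then show "numer n (swap_vec n j \<mu>) (Transposition.transpose j (Suc j) r) c /
      denom n (swap_vec n j \<mu>) (Transposition.transpose j (Suc j) r) c =
      numer n \<mu> r c / denom n \<mu> r c"
    unfolding numer_def denom_def v_perm_swap_vec[OF assms(1-3)] swap_vec_transpose[OF assms(1,3)]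
    by simp
qed

text \<open>The two rows differ only in column \<mu>_(j+1) + 1, where u rises by 1 and the
  denominator changes from 1 - t a to 1 - a.\<close>

lemma row_factor_swap_vec_descent:
  assumes "\<mu> \<in> nonneg_vecs n" and j: "j \<in> {1..<n}" and desc: "\<mu> j > \<mu> (j + 1)"
  defines "a \<equiv> q_K powi (\<mu> j - \<mu> (j + 1)) * t_K powi (int (v_perm n \<mu> j) - int (v_perm n \<mu> (j + 1)))"
  shows "row_factor n (swap_vec n j \<mu>) (j + 1) = (1 - t_K * a) / (1 - a) * row_factor n \<mu> j"
proof -
  let ?\<nu> = "swap_vec n j \<mu>" and ?s = "Transposition.transpose j (Suc j)"
  define c0 where "c0 = \<mu> (j + 1) + 1"
  have j': "j \<in> {1..n}" "j + 1 \<in> {1..n}" using j by auto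
  have s: "?s j = j + 1" by simp
  have \<nu>: "?\<nu> (j + 1) = \<mu> j" using swap_vec_transpose[OF j j'(1)] by simp
  have v: "v_perm n ?\<nu> (j + 1) = v_perm n \<mu> j" using v_perm_swap_vec[OF j desc j'(1)] by simp
  have "0 \<le> \<mu> (j + 1)" using assms(1) j'(2) by (auto simp: nonneg_vecs_def)
  then have c0: "c0 \<in> {1..\<mu> j}" using desc by (simp add: c0_def)
  have num: "numer n ?\<nu> (j + 1) c = numer n \<mu> j c" for c unfolding numer_def v ..
  have den: "denom n ?\<nu> (j + 1) c = denom n \<mu> j c" if "c \<noteq> c0" for c
  proof -
    have "u_stat n ?\<nu> (j + 1) c = u_stat n \<mu> j c"
      using u_stat_swap_vec[OF j desc j'(1), of c] that by (simp add: c0_def)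
    then show ?thesis unfolding denom_def \<nu> v by simp
  qed
  have "denom n ?\<nu> (j + 1) c0 = 1 - a"
    unfolding denom_def c0_def u_stat_swap_box(2)[OF j desc] v \<nu> a_def by (simp add: algebra_simps)
  moreover have "denom n \<mu> j c0 = 1 - t_K * a"
  proof -
    have "int (u_stat n \<mu> j c0) = int (v_perm n \<mu> (j + 1)) - 1"
      using u_stat_swap_box(1)[OF j desc] unfolding c0_def by linarith
    then have "int (v_perm n \<mu> j) - int (u_stat n \<mu> j c0) =
        (int (v_perm n \<mu> j) - int (v_perm n \<mu> (j + 1))) + 1" by simp
    then show ?thesis
      unfolding denom_def a_def by (simp only: power_int_add_1) (simp add: c0_def power_int_add_1)
  qed
  moreover have "denom n \<mu> j c0 \<noteq> 0" using c0 by (intro denom_nonzero) auto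
  ultimately have "numer n ?\<nu> (j + 1) c0 / denom n ?\<nu> (j + 1) c0 =
      (1 - t_K * a) / (1 - a) * (numer n \<mu> j c0 / denom n \<mu> j c0)"
    unfolding num by simp
  moreover have "(\<Prod>c \<in> {1..\<mu> j} - {c0}. numer n ?\<nu> (j + 1) c / denom n ?\<nu> (j + 1) c) =
      (\<Prod>c \<in> {1..\<mu> j} - {c0}. numer n \<mu> j c / denom n \<mu> j c)"
    by (intro prod.cong) (simp_all add: num den del: One_nat_def add_Suc_right)
  moreover have "prod f {1..\<mu> j} = f c0 * prod f ({1..\<mu> j} - {c0})" for f :: "int \<Rightarrow> K"
    using c0 by (intro prod.remove) auto
  ultimately show ?thesis
    unfolding row_factor_def \<nu> by (simp only: mult.assoc)
qed

lemma box_product_swap_vec: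
  assumes "\<mu> \<in> nonneg_vecs n" and j: "j \<in> {1..<n}" and desc: "\<mu> j > \<mu> (j + 1)"
  defines "a \<equiv> q_K powi (\<mu> j - \<mu> (j + 1)) * t_K powi (int (v_perm n \<mu> j) - int (v_perm n \<mu> (j + 1)))"
  shows "box_product n (swap_vec n j \<mu>) = (1 - t_K * a) / (1 - a) * box_product n \<mu>"
proof -
  let ?R = "\<lambda>r. row_factor n (swap_vec n j \<mu>) (Transposition.transpose j (Suc j) r)"
  have j': "j \<in> {1..n}" using j by auto
  have "box_product n (swap_vec n j \<mu>) = (\<Prod>r = 1..n. ?R r)"
    unfolding box_product_rows by (rule prod.reindex_bij_betw[OF bij_betw_transpose_Suc[OF j], symmetric])
  also have "\<dots> = ?R j * (\<Prod>r \<in> {1..n} - {j}. ?R r)" using j' by (intro prod.remove) auto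
  also have "(\<Prod>r \<in> {1..n} - {j}. ?R r) = (\<Prod>r \<in> {1..n} - {j}. row_factor n \<mu> r)"
    by (intro prod.cong row_factor_swap_vec j desc) auto
  also have "?R j = (1 - t_K * a) / (1 - a) * row_factor n \<mu> j"
    using row_factor_swap_vec_descent[OF assms(1) j desc] by (simp add: a_def)
  also have "\<dots> * (\<Prod>r \<in> {1..n} - {j}. row_factor n \<mu> r) =
      (1 - t_K * a) / (1 - a) * (row_factor n \<mu> j * (\<Prod>r \<in> {1..n} - {j}. row_factor n \<mu> r))"
    by (simp only: mult.assoc)
  also have "row_factor n \<mu> j * (\<Prod>r \<in> {1..n} - {j}. row_factor n \<mu> r) = box_product n \<mu>"
    unfolding box_product_rows using j' by (intro prod.remove[symmetric]) auto
  finally show ?thesis .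
qed

section \<open>The evaluation formula\<close>

lemma joint_eigen_cong:
  assumes "joint_eigen n y F" "\<And>i. i \<in> {1..n} \<Longrightarrow> y i = y' i"
  shows "joint_eigen n y' F"
  using assms unfolding joint_eigen_def by auto

lemma joint_eigen_scale:
  assumes "joint_eigen n y F"
  shows "joint_eigen n y (scale c F)"
  using assms unfolding joint_eigen_def by (auto simp: mult.commute)

text \<open>The eigenvalue of Y_i on E_\<mu>. The term -i in the exponent of t reflects the
  normalization of the S_i: after multiplication by t^i these numbers are permuted by the
  swaps.\<close>

definition spectral :: "nat \<Rightarrow> (nat \<Rightarrow> int) \<Rightarrow> nat \<Rightarrow> K" where
  "spectral n \<mu> i = q_K powi (- \<mu> i) * t_K powi (int n + 1 - int i - int (v_perm n \<mu> i))"

lemma v_perm_zero: "r \<in> {1..n} \<Longrightarrow> v_perm n (\<lambda>i\<in>{1..n}. 0) r = r"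
proof -
  assume r: "r \<in> {1..n}"
  have "{a \<in> {1..n}. (\<lambda>i\<in>{1..n}. 0 :: int) a < (\<lambda>i\<in>{1..n}. 0) r \<or>
      (\<lambda>i\<in>{1..n}. 0 :: int) a = (\<lambda>i\<in>{1..n}. 0) r \<and> a < r} = {1..<r}"
    using r by auto
  then show ?thesis using r unfolding v_perm_eq_card[OF r] by simp
qed

lemma spectral_swap_vec:
  assumes j: "j \<in> {1..<n}" and desc: "\<mu> j > \<mu> (j + 1)" and i: "i \<in> {1..n}"
  defines "y \<equiv> spectral n \<mu>"
  shows "(y(j := t_K * y (Suc j), Suc j := y j / t_K)) i = spectral n (swap_vec n j \<mu>) i"
proof -
  have *: "swap_vec n j \<mu> i = \<mu> (Transposition.transpose j (Suc j) i)"
    "v_perm n (swap_vec n j \<mu>) i = v_perm n \<mu> (Transposition.transpose j (Suc j) i)"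
    using v_perm_swap_vec[OF j desc transpose_Suc_in[OF j i]] i by (simp_all add: swap_vec_apply)
  consider "i = j" | "i = Suc j" | "i \<noteq> j" "i \<noteq> Suc j" by blast
  then show ?thesis
  proof cases
    case 1
    have "spectral n (swap_vec n j \<mu>) i =
        q_K powi (- \<mu> (Suc j)) * t_K powi (int n + 1 - int j - int (v_perm n \<mu> (Suc j)))"
      unfolding spectral_def * using 1 by simp
    also have "t_K powi (int n + 1 - int j - int (v_perm n \<mu> (Suc j))) =
        t_K powi (int n + 1 - int (Suc j) - int (v_perm n \<mu> (Suc j))) * t_K"
      by (subst power_int_add_1[symmetric]) (auto simp: algebra_simps)
    also have "q_K powi (- \<mu> (Suc j)) * \<dots> = t_K * y (Suc j)"
      by (simp only: spectral_def y_def mult_ac)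
    finally show ?thesis using 1 by simp
  next
    case 2
    have "spectral n (swap_vec n j \<mu>) i =
        q_K powi (- \<mu> j) * t_K powi (int n + 1 - int (Suc j) - int (v_perm n \<mu> j))"
      unfolding spectral_def * using 2 by simp
    moreover have "t_K powi (int n + 1 - int j - int (v_perm n \<mu> j)) =
        t_K powi (int n + 1 - int (Suc j) - int (v_perm n \<mu> j)) * t_K"
      by (subst power_int_add_1[symmetric]) (auto simp: algebra_simps)
    then have "y j = q_K powi (- \<mu> j) * t_K powi (int n + 1 - int (Suc j) - int (v_perm n \<mu> j)) * t_K"
      by (simp only: spectral_def y_def mult.assoc)
    ultimately show ?thesis using 2 by simp
  next
    case 3
    then show ?thesis by (simp add: spectral_def y_def * transpose_def)
  qed
qed

lemma spectral_rotate_vec: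
  fixes \<mu> :: "nat \<Rightarrow> int"
  assumes n: "1 \<le> n" and i: "i \<in> {1..n}"
  defines "y \<equiv> spectral n \<mu>"
  shows "(if i = 1 then inverse q_K * t_K ^ (n - 1) * y n else y (i - 1) / t_K) =
    spectral n (rotate_vec n \<mu>) i"
proof (cases "i = 1")
  case True
  have "rotate_vec n \<mu> 1 = \<mu> n + 1" "v_perm n (rotate_vec n \<mu>) 1 = v_perm n \<mu> n"
    using n v_perm_rotate_vec[of n n \<mu>] by (auto simp: rotate_vec_def rotate_index_def)
  moreover have "t_K powi (int n + 1 - int 1 - int (v_perm n \<mu> n)) =
      t_K ^ (n - 1) * t_K powi (int n + 1 - int n - int (v_perm n \<mu> n))"
    unfolding power_int_of_nat[symmetric] using n
    by (subst power_int_add[symmetric]) (auto simp: of_nat_diff)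
  moreover have "q_K powi (- (\<mu> n + 1)) = inverse q_K * q_K powi (- \<mu> n)"
    unfolding power_int_minus by (simp add: power_int_add_1)
  ultimately show ?thesis using True by (simp only: spectral_def y_def if_True) (simp add: mult_ac)
next
  case False
  then obtain k where k: "i = Suc k" "k \<in> {1..n}" "k < n" using i by (cases i) auto
  have *: "rotate_vec n \<mu> i = \<mu> k" "v_perm n (rotate_vec n \<mu>) i = v_perm n \<mu> k"
    using k v_perm_rotate_vec[of k n \<mu>] by (auto simp: rotate_vec_def rotate_index_def)
  have "t_K powi (int n + 1 - int k - int (v_perm n \<mu> k)) =
      t_K powi (int n + 1 - int (Suc k) - int (v_perm n \<mu> k)) * t_K"
    by (subst power_int_add_1[symmetric]) (auto simp: algebra_simps)
  then have "y k = q_K powi (- \<mu> k) * t_K powi (int n + 1 - int (Suc k) - int (v_perm n \<mu> k)) * t_K"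
    by (simp only: spectral_def y_def mult.assoc)
  moreover have "spectral n (rotate_vec n \<mu>) i =
      q_K powi (- \<mu> k) * t_K powi (int n + 1 - int (Suc k) - int (v_perm n \<mu> k))"
    unfolding spectral_def * using k by simp
  ultimately show ?thesis using False k by simp
qed

text \<open>The constant simplifies to (1 - t) / (1 - a), and subtracting 1 - t from it has the
  effect of multiplying it by a = t y_2 / y_1. Hence the constant of (E2) is the one an intertwiner
  requires.\<close>

lemma intertwiner_coefficient:
  fixes y\<^sub>1 y\<^sub>2 t a :: "'a :: field"
  assumes "y\<^sub>1 \<noteq> 0" "a * y\<^sub>1 = t * y\<^sub>2" "a \<noteq> 1"
  shows "(t - 1 + (1 - t + (1 - t) * a / (1 - a))) * y\<^sub>1 = (1 - t + (1 - t) * a / (1 - a)) * t * y\<^sub>2"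
proof -
  have "1 - t + (1 - t) * a / (1 - a) = (1 - t) / (1 - a)"
    using assms(3) by (simp add: field_simps)
  moreover have "t - 1 + (1 - t + (1 - t) * a / (1 - a)) = (1 - t) / (1 - a) * a" by simp
  ultimately show ?thesis using assms(2) by (simp only: mult.assoc)
qed

section \<open>The recursions for the principal value\<close>

definition principal_value :: "nat \<Rightarrow> (nat \<Rightarrow> int) \<Rightarrow> K" where
  "principal_value n \<mu> = t_K powi n_stat n (decreasing_rearrangement n \<mu>) * box_product n \<mu>"

lemma macdonald_zero:
  assumes "f = 1"
  shows "joint_eigen n (spectral n (\<lambda>i\<in>{1..n}. 0)) (laurent_fun f) \<and>
     laurent_fun f principal_point = principal_value n (\<lambda>i\<in>{1..n}. 0)"
proof
  have const: "laurent_fun f = (\<lambda>_. 1)" by (simp add: fun_eq_iff laurent_fun_def assms)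
  show "joint_eigen n (spectral n (\<lambda>i\<in>{1..n}. 0)) (laurent_fun f)"
    unfolding const using joint_eigen_const
  proof (rule joint_eigen_cong)
    fix i assume "i \<in> {1..n}"
    moreover from this have "v_perm n (\<lambda>i\<in>{1..n}. 0) i = i" by (rule v_perm_zero)
    ultimately show "t_K powi (int n + 1 - 2 * int i) = spectral n (\<lambda>i\<in>{1..n}. 0) i"
      by (simp add: spectral_def)
  qed
  have "n_stat n (decreasing_rearrangement n (\<lambda>i\<in>{1..n}. 0)) = 0"
    unfolding n_stat_decreasing_rearrangement by simp
  moreover have "boxes n (\<lambda>i\<in>{1..n}. 0) = {}" by (auto simp: boxes_def)
  ultimately show "laurent_fun f principal_point = principal_value n (\<lambda>i\<in>{1..n}. 0)"
    by (simp add: const principal_value_def box_product_def)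
qed

text \<open>The value is multiplied by q^(\<mu>_n) from (E1), by x_1 = 1, and by y_n t^(n-1) from
  the rotated point. The product t^(n - v(n)) is the change of t^n(\<lambda>), while the box product
  stays the same.\<close>

lemma macdonald_rotate:
  assumes \<mu>: "\<mu> \<in> nonneg_vecs n" and n: "1 \<le> n"
    and eigen: "joint_eigen n (spectral n \<mu>) F" and val: "F principal_point = principal_value n \<mu>"
    and G: "G = scale (q_K powi \<mu> n) (x_mult 1 (rot n F))"
  shows "joint_eigen n (spectral n (rotate_vec n \<mu>)) G \<and>
     G principal_point = principal_value n (rotate_vec n \<mu>)"
proof
  show "joint_eigen n (spectral n (rotate_vec n \<mu>)) G"
    unfolding G
    by (rule joint_eigen_scale, rule joint_eigen_cong[OF joint_eigen_rotation[OF eigen n]])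
      (rule spectral_rotate_vec[OF n])
  have "t_K powi (int n + 1 - int n - int (v_perm n \<mu> n)) * t_K ^ (n - 1) =
      t_K powi (int n - int (v_perm n \<mu> n))"
    unfolding power_int_of_nat[symmetric] using n
    by (subst power_int_add[symmetric]) (auto simp: of_nat_diff)
  moreover have "q_K powi \<mu> n * q_K powi (- \<mu> n) = 1" by (simp add: power_int_minus)
  ultimately have "q_K powi \<mu> n * (spectral n \<mu> n * t_K ^ (n - 1)) = t_K powi (int n - int (v_perm n \<mu> n))"
    unfolding spectral_def by (metis (no_types, lifting) mult.assoc mult_1)
  moreover have "coord principal_point 1 = 1" by (simp add: principal_point.rep_eq)
  ultimately have "G principal_point = t_K powi (int n - int (v_perm n \<mu> n)) * principal_value n \<mu>"
    using joint_eigen_principal_point[OF eigen n]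
    by (simp only: G scale_def x_mult_def rot_def val mult.assoc mult_1) (simp only: mult.assoc[symmetric])
  also have "\<dots> = principal_value n (rotate_vec n \<mu>)"
    unfolding principal_value_def box_product_rotate_vec[OF \<mu> n] n_stat_rotate_vec[OF n]
    by (simp add: power_int_add power_int_diff field_simps)
  finally show "G principal_point = principal_value n (rotate_vec n \<mu>)" .
qed

text \<open>The parameter \<open>a\<close> is t times a ratio of neighbouring eigenvalues, so (E2)
  applies an intertwiner. At the principal point it multiplies by t + d = (1 - t a) / (1 - a), the
  factor gained by the box product.\<close>

lemma macdonald_swap:
  assumes \<mu>: "\<mu> \<in> nonneg_vecs n" and j: "j \<in> {1..<n}" and desc: "\<mu> j > \<mu> (j + 1)"
    and eigen: "joint_eigen n (spectral n \<mu>) F" and val: "F principal_point = principal_value n \<mu>"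
  defines "a \<equiv> q_K powi (\<mu> j - \<mu> (j + 1)) * t_K powi (int (v_perm n \<mu> j) - int (v_perm n \<mu> (j + 1)))"
  assumes G: "G = plus_fn (hecke j F) (scale (1 - t_K + (1 - t_K) * a / (1 - a)) F)"
  shows "joint_eigen n (spectral n (swap_vec n j \<mu>)) G \<and>
     G principal_point = principal_value n (swap_vec n j \<mu>)"
proof
  let ?d = "1 - t_K + (1 - t_K) * a / (1 - a)"
  have a: "a \<noteq> 1" unfolding a_def using desc by (simp add: q_t_powi_eq_1_iff)
  have "a * spectral n \<mu> j = t_K * spectral n \<mu> (Suc j)"
  proof -
    have q: "q_K powi (\<mu> j - \<mu> (j + 1)) * q_K powi (- \<mu> j) = q_K powi (- \<mu> (Suc j))"
      by (subst power_int_add[symmetric]) auto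
    have t: "t_K powi (int (v_perm n \<mu> j) - int (v_perm n \<mu> (j + 1))) *
        t_K powi (int n + 1 - int j - int (v_perm n \<mu> j)) =
        t_K * t_K powi (int n + 1 - int (Suc j) - int (v_perm n \<mu> (Suc j)))"
      by (subst power_int_add[symmetric], simp, subst power_int_add_1'[symmetric]) (auto simp: algebra_simps)
    have "a * spectral n \<mu> j = (q_K powi (\<mu> j - \<mu> (j + 1)) * q_K powi (- \<mu> j)) *
        (t_K powi (int (v_perm n \<mu> j) - int (v_perm n \<mu> (j + 1))) *
        t_K powi (int n + 1 - int j - int (v_perm n \<mu> j)))"
      unfolding a_def spectral_def by (simp only: mult_ac)
    then show ?thesis unfolding q t by (simp only: spectral_def mult_ac)
  qed
  then have coeff: "(t_K - 1 + ?d) * spectral n \<mu> j = ?d * t_K * spectral n \<mu> (Suc j)"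
    using a by (intro intertwiner_coefficient) (simp_all add: spectral_def)
  show "joint_eigen n (spectral n (swap_vec n j \<mu>)) G"
    unfolding G using j
    by (intro joint_eigen_cong[OF joint_eigen_intertwiner[OF eigen _ _ coeff]] spectral_swap_vec[OF j desc]) auto
  have "t_K + ?d = (1 - t_K * a) / (1 - a)" using a by (simp add: field_simps)
  moreover have "G principal_point = (t_K + ?d) * principal_value n \<mu>"
    using j by (simp add: G plus_fn_def scale_def hecke_principal_point val algebra_simps)
  ultimately show "G principal_point = principal_value n (swap_vec n j \<mu>)"
    unfolding principal_value_def box_product_swap_vec[OF \<mu> j desc, folded a_def] n_stat_swap_vec[OF j desc]
    by (simp only: mult_ac)
qed

theorem theorem5p4:
  fixes n :: nat and \<mu> lam :: "nat \<Rightarrow> int" and E :: "(nat \<Rightarrow> int) \<Rightarrow> laurent"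
  assumes "n \<ge> 1"
    and "electronic_macdonald n E"
    and "\<mu> \<in> nonneg_vecs n"
    and "lam = decreasing_rearrangement n \<mu>"
  shows "laurent_eval (\<lambda>i. t_K ^ (i - 1)) (E \<mu>) =
    t_K powi n_stat n lam *
    (\<Prod>(r, c) \<in> boxes n \<mu>.
       (1 - q_K powi c * t_K ^ v_perm n \<mu> r) /
       (1 - q_K powi (\<mu> r - c + 1) * t_K powi (int (v_perm n \<mu> r) - int (u_stat n \<mu> r c))))"
proof -
  note E = assms(2)[unfolded electronic_macdonald_def]
  have int: "\<nu> \<in> int_vecs n" if "\<nu> \<in> nonneg_vecs n" for \<nu>
    using that by (auto simp: nonneg_vecs_def int_vecs_def)
  have ring: "E \<nu> \<in> laurent_ring n" if "\<nu> \<in> nonneg_vecs n" for \<nu>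
    using E int[OF that] by blast
  have E0: "E (\<lambda>i\<in>{1..n}. 0) = 1" using E by blast
  have E1: "E (rotate_vec n \<nu>) = const_L (q_K powi \<nu> n) * x_var 1 *
      laurent_subst (\<lambda>i. if i = n then inverse q_K else 1) (\<lambda>i. if i = n then 1 else i + 1) (E \<nu>)"
    if "\<nu> \<in> nonneg_vecs n" for \<nu>
    using E int[OF that] unfolding rotate_vec_def by blast
  have E2: "E (swap_vec n j \<nu>) = divdiff j (x_var j * E \<nu>) - const_L t_K * x_var j * divdiff j (E \<nu>) +
      const_L ((1 - t_K) * a / (1 - a)) * E \<nu>"
    if "\<nu> \<in> nonneg_vecs n" "j \<in> {1..<n}" "\<nu> j > \<nu> (j + 1)"
      "a = q_K powi (\<nu> j - \<nu> (j + 1)) * t_K powi (int (v_perm n \<nu> j) - int (v_perm n \<nu> (j + 1)))" for \<nu> j a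
    using E that unfolding swap_vec_def Let_def by blast
  \<comment> \<open>The eigenvector property is carried along with the value, since the rotation
    step needs it to return to the principal point.\<close>
  have "joint_eigen n (spectral n \<mu>) (laurent_fun (E \<mu>)) \<and> laurent_fun (E \<mu>) principal_point = principal_value n \<mu>"
    using assms(1,3)
  proof (induction \<mu> rule: nonneg_vecs_induct)
    case zero
    show ?case by (rule macdonald_zero[OF E0])
  next
    case (rotate \<nu>)
    then show ?case
      by (intro macdonald_rotate[of \<nu> n "laurent_fun (E \<nu>)"] assms(1))
        (auto simp only: E1 laurent_fun_rotation[OF ring assms(1)])
  next
    case (swap \<nu> j)
    then show ?case
      by (intro macdonald_swap[of \<nu> n j "laurent_fun (E \<nu>)"]) (auto simp only: E2[OF swap(1-3) refl] laurent_fun_demazure_lusztig)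
  qed
  then have "laurent_eval (\<lambda>i. t_K ^ (i - 1)) (E \<mu>) = principal_value n \<mu>"
    by (simp add: laurent_fun_principal_point[OF ring[OF assms(3)]])
  then show ?thesis
    unfolding principal_value_def box_product_def numer_def denom_def assms(4) .
qed

end
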